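(* Let $K$ be an expansion of a field, with finite dp-rank $n < \infty$. Let $\tau$ be a definable field topology on $K$. Then $\tau$ has breadth $\le n$.
   Context: An expansion of a field is a first-order structure $(K,+,\cdot,\ldots)$ expanding a field. A field topology on $K$ is a Hausdorff, non-discrete topology for which the field operations (including division) are continuous. "Definable" means definable with parameters. A topology on a definable set is definable if some uniformly definable family of sets is a basis of open sets. dp-rank: the structure $K$ has dp-rank $\ge n$ if, in some elementary extension $K^*$, there are formulas $\varphi_i(x,y_i)$ ($i<n$, $x$ a single variable) and parameters $b_{i,j}$ ($i<n$, $j<\omega$) such that for every $\eta : n \to \omega$ there is $a \in K^*$ with $\varphi_i(a,b_{i,j}) \iff j=\eta(i)$ for all $i,j$. It has dp-rank $n<\infty$ if it has dp-rank $\ge n$ but not $\ge n+1$. (Finite dp-rank implies NIP.) A set $B \subseteq K$ is bounded (with respect to $\tau$) if for every neighborhood $U$ of $0$ there is $c \in K^\times$ with $cB \subseteq U$; $\tau$ is locally bounded if some neighborhood of $0$ is bounded. For $n \ge 1$, a $W_n$-set on $K$ is a set $X \subseteq K$ such that for any $a_0,a_1,\ldots,a_n \in K$ there is some $i$ such that $$a_i \in a_0 \cdot X + \cdots + \widehat{a_i \cdot X} + \cdots + a_n \cdot X,$$ where the hat denotes omission. The topology $\tau$ is a $W_n$-topology, equivalently has breadth $\le n$, if $\tau$ is locally bounded and there is a bounded $W_n$-set $B \subseteq K$. *)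

theory Defs
  imports "HOL-Analysis.T1_Spaces"
begin

section \<open>First-order languages and structures\<close>

text \<open>
  A language is a pair of partial arity functions; a symbol on which they are undefined does not
  belong to the language.
\<close>

record ('f, 'r) language =
  fun_arity :: "'f \<Rightarrow> nat option"
  rel_arity :: "'r \<Rightarrow> nat option"

datatype 'f trm = Var nat | App 'f "'f trm list"

datatype ('f, 'r) fm =
    Equal "'f trm" "'f trm"
  | Pred 'r "'f trm list"
  | Neg "('f, 'r) fm"
  | Conj "('f, 'r) fm" "('f, 'r) fm"
  | Exists nat "('f, 'r) fm"

fun wf_trm :: "('f, 'r) language \<Rightarrow> 'f trm \<Rightarrow> bool" where
  "wf_trm L (Var v) \<longleftrightarrow> True"
| "wf_trm L (App f ts) \<longleftrightarrow> fun_arity L f = Some (length ts) \<and> (\<forall>t\<in>set ts. wf_trm L t)"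

fun wf_fm :: "('f, 'r) language \<Rightarrow> ('f, 'r) fm \<Rightarrow> bool" where
  "wf_fm L (Equal s t) \<longleftrightarrow> wf_trm L s \<and> wf_trm L t"
| "wf_fm L (Pred r ts) \<longleftrightarrow> rel_arity L r = Some (length ts) \<and> (\<forall>t\<in>set ts. wf_trm L t)"
| "wf_fm L (Neg p) \<longleftrightarrow> wf_fm L p"
| "wf_fm L (Conj p q) \<longleftrightarrow> wf_fm L p \<and> wf_fm L q"
| "wf_fm L (Exists v p) \<longleftrightarrow> wf_fm L p"

record ('f, 'r, 'a) fo_structure =
  universe :: "'a set"
  fun_int :: "'f \<Rightarrow> 'a list \<Rightarrow> 'a"
  rel_int :: "'r \<Rightarrow> 'a list \<Rightarrow> bool"

definition is_structure :: "('f, 'r) language \<Rightarrow> ('f, 'r, 'a) fo_structure \<Rightarrow> bool" where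
  "is_structure L M \<longleftrightarrow> universe M \<noteq> {} \<and>
     (\<forall>f xs. fun_arity L f = Some (length xs) \<and> set xs \<subseteq> universe M \<longrightarrow> fun_int M f xs \<in> universe M)"

fun trm_val :: "('f, 'r, 'a) fo_structure \<Rightarrow> (nat \<Rightarrow> 'a) \<Rightarrow> 'f trm \<Rightarrow> 'a" where
  "trm_val M \<sigma> (Var v) = \<sigma> v"
| "trm_val M \<sigma> (App f ts) = fun_int M f (map (trm_val M \<sigma>) ts)"

fun sat :: "('f, 'r, 'a) fo_structure \<Rightarrow> (nat \<Rightarrow> 'a) \<Rightarrow> ('f, 'r) fm \<Rightarrow> bool" where
  "sat M \<sigma> (Equal s t) \<longleftrightarrow> trm_val M \<sigma> s = trm_val M \<sigma> t"
| "sat M \<sigma> (Pred r ts) \<longleftrightarrow> rel_int M r (map (trm_val M \<sigma>) ts)"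
| "sat M \<sigma> (Neg p) \<longleftrightarrow> \<not> sat M \<sigma> p"
| "sat M \<sigma> (Conj p q) \<longleftrightarrow> sat M \<sigma> p \<and> sat M \<sigma> q"
| "sat M \<sigma> (Exists v p) \<longleftrightarrow> (\<exists>a\<in>universe M. sat M (\<sigma>(v := a)) p)"

text \<open>
  Up to replacing \<open>M\<close> by its image, this says that \<open>N\<close> is an elementary extension of \<open>M\<close>.
\<close>

definition elementary_embedding ::
  "('f, 'r) language \<Rightarrow> ('f, 'r, 'a) fo_structure \<Rightarrow> ('a \<Rightarrow> 'b) \<Rightarrow> ('f, 'r, 'b) fo_structure \<Rightarrow> bool"
where
  "elementary_embedding L M h N \<longleftrightarrow> h ` universe M \<subseteq> universe N \<and>
     (\<forall>\<phi> \<sigma>. wf_fm L \<phi> \<and> range \<sigma> \<subseteq> universe M \<longrightarrow> (sat N (h \<circ> \<sigma>) \<phi> \<longleftrightarrow> sat M \<sigma> \<phi>))"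

text \<open>
  The assignment that gives the variables \<open>0, \<dots>, length xs - 1\<close> the values \<open>xs\<close> and the later
  variables the values \<open>\<sigma> 0, \<sigma> 1, \<dots>\<close>. A formula uses only finitely many of the latter, so
  \<open>\<sigma>\<close> plays the part of a finite tuple of parameters.
\<close>

definition env :: "'a list \<Rightarrow> (nat \<Rightarrow> 'a) \<Rightarrow> nat \<Rightarrow> 'a" where
  "env xs \<sigma> v = (if v < length xs then xs ! v else \<sigma> (v - length xs))"

section \<open>Definable sets and families\<close>

definition definable :: "('f, 'r) language \<Rightarrow> ('f, 'r, 'a) fo_structure \<Rightarrow> nat \<Rightarrow> 'a list set \<Rightarrow> bool" where
  "definable L M m S \<longleftrightarrow> (\<exists>\<phi> \<sigma>. wf_fm L \<phi> \<and> range \<sigma> \<subseteq> universe M \<and>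
     S = {xs. length xs = m \<and> set xs \<subseteq> universe M \<and> sat M (env xs \<sigma>) \<phi>})"

text \<open>A definable set \<open>Y\<close> of indices, and the fibres over \<open>Y\<close> of a definable set \<open>Z\<close>.\<close>

definition uniformly_definable ::
  "('f, 'r) language \<Rightarrow> ('f, 'r, 'a) fo_structure \<Rightarrow> 'a set set \<Rightarrow> bool" where
  "uniformly_definable L M \<F> \<longleftrightarrow> (\<exists>m Y Z. definable L M m Y \<and> definable L M (Suc m) Z \<and>
     \<F> = {{a. a # y \<in> Z} | y. y \<in> Y})"

definition definable_topology ::
  "('f, 'r) language \<Rightarrow> ('f, 'r, 'a) fo_structure \<Rightarrow> 'a topology \<Rightarrow> bool" where
  "definable_topology L M T \<longleftrightarrow> topspace T = universe M \<and>
     (\<exists>\<B>. uniformly_definable L M \<B> \<and> openin T = arbitrary union_of (\<lambda>B. B \<in> \<B>))"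

section \<open>dp-rank\<close>

definition has_ict_pattern :: "('f, 'r) language \<Rightarrow> ('f, 'r, 'a) fo_structure \<Rightarrow> nat \<Rightarrow> bool" where
  "has_ict_pattern L N n \<longleftrightarrow> (\<exists>(\<phi> :: nat \<Rightarrow> ('f, 'r) fm) (b :: nat \<Rightarrow> nat \<Rightarrow> nat \<Rightarrow> 'a).
     (\<forall>i<n. wf_fm L (\<phi> i)) \<and> (\<forall>i<n. \<forall>j. range (b i j) \<subseteq> universe N) \<and>
     (\<forall>\<eta> :: nat \<Rightarrow> nat. \<exists>a\<in>universe N. \<forall>i<n. \<forall>j. sat N (env [a] (b i j)) (\<phi> i) \<longleftrightarrow> j = \<eta> i))"

text \<open>
  HOL cannot quantify over the type carrying the elementary extension. The type
  \<open>(nat \<Rightarrow> 'a) set\<close> carries the countable ultrapowers of \<open>M\<close>, which is enough: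
  by lemma \<open>dp_rank_geI\<close> below, an elementary extension over any other type that has such a
  pattern also witnesses \<open>dp_rank_ge\<close>.
\<close>

definition dp_rank_ge :: "('f, 'r) language \<Rightarrow> ('f, 'r, 'a) fo_structure \<Rightarrow> nat \<Rightarrow> bool" where
  "dp_rank_ge L M n \<longleftrightarrow> (\<exists>(N :: ('f, 'r, (nat \<Rightarrow> 'a) set) fo_structure) h.
     is_structure L N \<and> elementary_embedding L M h N \<and> has_ict_pattern L N n)"

definition has_dp_rank :: "('f, 'r) language \<Rightarrow> ('f, 'r, 'a) fo_structure \<Rightarrow> nat \<Rightarrow> bool" where
  "has_dp_rank L M n \<longleftrightarrow> dp_rank_ge L M n \<and> \<not> dp_rank_ge L M (Suc n)"

section \<open>Expansions of fields and field topologies\<close>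

definition field_expansion :: "('f, 'r) language \<Rightarrow> ('f, 'r, 'a::field) fo_structure \<Rightarrow> bool" where
  "field_expansion L K \<longleftrightarrow> is_structure L K \<and> universe K = UNIV \<and>
     (\<exists>f. fun_arity L f = Some 2 \<and> (\<forall>x y. fun_int K f [x, y] = x + y)) \<and>
     (\<exists>f. fun_arity L f = Some 2 \<and> (\<forall>x y. fun_int K f [x, y] = x * y))"

definition field_topology :: "'a::field topology \<Rightarrow> bool" where
  "field_topology T \<longleftrightarrow> topspace T = UNIV \<and> Hausdorff_space T \<and> T \<noteq> discrete_topology UNIV \<and>
     continuous_map (prod_topology T T) T (\<lambda>(x, y). x + y) \<and>
     continuous_map (prod_topology T T) T (\<lambda>(x, y). x - y) \<and>
     continuous_map (prod_topology T T) T (\<lambda>(x, y). x * y) \<and>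
     continuous_map (prod_topology T (subtopology T (- {0}))) T (\<lambda>(x, y). x / y)"

definition nbhd_zero :: "'a::field topology \<Rightarrow> 'a set \<Rightarrow> bool" where
  "nbhd_zero T U \<longleftrightarrow> (\<exists>V. openin T V \<and> 0 \<in> V \<and> V \<subseteq> U)"

definition bounded_set :: "'a::field topology \<Rightarrow> 'a set \<Rightarrow> bool" where
  "bounded_set T B \<longleftrightarrow> (\<forall>U. nbhd_zero T U \<longrightarrow> (\<exists>c. c \<noteq> 0 \<and> (\<lambda>x. c * x) ` B \<subseteq> U))"

definition locally_bounded :: "'a::field topology \<Rightarrow> bool" where
  "locally_bounded T \<longleftrightarrow> (\<exists>U. nbhd_zero T U \<and> bounded_set T U)"

definition W_set :: "nat \<Rightarrow> 'a::field set \<Rightarrow> bool" where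
  "W_set n X \<longleftrightarrow> (\<forall>a :: nat \<Rightarrow> 'a. \<exists>i\<le>n. \<exists>x. (\<forall>j\<in>{..n} - {i}. x j \<in> X) \<and>
     a i = (\<Sum>j\<in>{..n} - {i}. a j * x j))"

definition breadth_le :: "'a::field topology \<Rightarrow> nat \<Rightarrow> bool" where
  "breadth_le T n \<longleftrightarrow> locally_bounded T \<and> (\<exists>B. bounded_set T B \<and> W_set n B)"

section \<open>Adequacy of the definition of dp-rank\<close>

text \<open>
  Nothing below enters into a definition above. A pattern in an elementary extension yields
  patterns of every finite length in \<open>M\<close>, by elementarity, and these yield a pattern
  in a countable ultrapower of \<open>M\<close>, by Los's theorem.
\<close>

primrec rn_trm :: "(nat \<Rightarrow> nat) \<Rightarrow> 'f trm \<Rightarrow> 'f trm" where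
  "rn_trm \<rho> (Var v) = Var (\<rho> v)"
| "rn_trm \<rho> (App f ts) = App f (map (rn_trm \<rho>) ts)"

primrec rn_fm :: "(nat \<Rightarrow> nat) \<Rightarrow> ('f, 'r) fm \<Rightarrow> ('f, 'r) fm" where
  "rn_fm \<rho> (Equal s t) = Equal (rn_trm \<rho> s) (rn_trm \<rho> t)"
| "rn_fm \<rho> (Pred r ts) = Pred r (map (rn_trm \<rho>) ts)"
| "rn_fm \<rho> (Neg p) = Neg (rn_fm \<rho> p)"
| "rn_fm \<rho> (Conj p q) = Conj (rn_fm \<rho> p) (rn_fm \<rho> q)"
| "rn_fm \<rho> (Exists v p) = Exists (\<rho> v) (rn_fm \<rho> p)"

lemma wf_rn_trm [simp]: "wf_trm L (rn_trm \<rho> t) = wf_trm L t"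
  by (induction t) auto

lemma wf_rn_fm [simp]: "wf_fm L (rn_fm \<rho> p) = wf_fm L p"
  by (induction p) auto

lemma trm_val_rn: "trm_val M \<sigma> (rn_trm \<rho> t) = trm_val M (\<sigma> \<circ> \<rho>) t"
  by (induction t) (auto cong: map_cong simp: o_def)

lemma sat_rn: "inj \<rho> \<Longrightarrow> sat M \<sigma> (rn_fm \<rho> p) \<longleftrightarrow> sat M (\<sigma> \<circ> \<rho>) p"
proof (induction p arbitrary: \<sigma>)
  case (Exists v p)
  have "(\<sigma>(\<rho> v := a)) \<circ> \<rho> = (\<sigma> \<circ> \<rho>)(v := a)" for a
    using Exists.prems by (auto simp: fun_eq_iff inj_eq)
  then have "sat M (\<sigma>(\<rho> v := a)) (rn_fm \<rho> p) \<longleftrightarrow> sat M ((\<sigma> \<circ> \<rho>)(v := a)) p" for a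
    using Exists by metis
  then show ?case by (simp add: o_def)
qed (auto simp: trm_val_rn cong: map_cong)

primrec fv_trm :: "'f trm \<Rightarrow> nat set" where
  "fv_trm (Var v) = {v}"
| "fv_trm (App f ts) = \<Union> (set (map fv_trm ts))"

primrec fv_fm :: "('f, 'r) fm \<Rightarrow> nat set" where
  "fv_fm (Equal s t) = fv_trm s \<union> fv_trm t"
| "fv_fm (Pred r ts) = \<Union> (set (map fv_trm ts))"
| "fv_fm (Neg p) = fv_fm p"
| "fv_fm (Conj p q) = fv_fm p \<union> fv_fm q"
| "fv_fm (Exists v p) = fv_fm p - {v}"

lemma finite_fv_trm: "finite (fv_trm t)"
  by (induction t) auto

lemma finite_fv_fm: "finite (fv_fm p)"
  by (induction p) (auto simp: finite_fv_trm)

lemma trm_val_cong: "(\<And>v. v \<in> fv_trm t \<Longrightarrow> \<sigma> v = \<tau> v) \<Longrightarrow> trm_val M \<sigma> t = trm_val M \<tau> t"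
proof (induction t)
  case (App f ts)
  then have "map (trm_val M \<sigma>) ts = map (trm_val M \<tau>) ts" by auto
  then show ?case by (simp del: map_eq_conv)
qed auto

lemma sat_cong: "(\<And>v. v \<in> fv_fm p \<Longrightarrow> \<sigma> v = \<tau> v) \<Longrightarrow> sat M \<sigma> p = sat M \<tau> p"
proof (induction p arbitrary: \<sigma> \<tau>)
  case (Equal s t)
  then show ?case using trm_val_cong[of s \<sigma> \<tau> M] trm_val_cong[of t \<sigma> \<tau> M] by auto
next
  case (Pred r ts)
  then have "map (trm_val M \<sigma>) ts = map (trm_val M \<tau>) ts"
    by (auto intro!: trm_val_cong)
  then show ?case by (simp del: map_eq_conv)
next
  case (Conj p q)
  have "sat M \<sigma> p = sat M \<tau> p"
    by (rule Conj.IH(1)) (use Conj.prems in simp)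
  moreover have "sat M \<sigma> q = sat M \<tau> q"
    by (rule Conj.IH(2)) (use Conj.prems in simp)
  ultimately show ?case by simp
next
  case (Exists v p)
  have "sat M (\<sigma>(v := a)) p = sat M (\<tau>(v := a)) p" for a
    by (rule Exists.IH) (use Exists.prems in auto)
  then show ?case by simp
next
  case (Neg p)
  have "sat M \<sigma> p = sat M \<tau> p"
    by (rule Neg.IH) (use Neg.prems in simp)
  then show ?case by simp
qed

definition TT :: "('f, 'r) fm" where
  "TT = Exists 0 (Equal (Var 0) (Var 0))"

definition Conjs :: "('f, 'r) fm list \<Rightarrow> ('f, 'r) fm" where
  "Conjs ps = foldr Conj ps TT"

lemma wf_Conjs [simp]: "wf_fm L (Conjs ps) \<longleftrightarrow> (\<forall>p\<in>set ps. wf_fm L p)"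
  by (induction ps) (auto simp: Conjs_def TT_def)

lemma sat_Conjs [simp]: "universe M \<noteq> {} \<Longrightarrow> sat M \<sigma> (Conjs ps) \<longleftrightarrow> (\<forall>p\<in>set ps. sat M \<sigma> p)"
  by (induction ps) (auto simp: Conjs_def TT_def)

definition Exs :: "nat list \<Rightarrow> ('f, 'r) fm \<Rightarrow> ('f, 'r) fm" where
  "Exs vs p = foldr Exists vs p"

lemma wf_Exs [simp]: "wf_fm L (Exs vs p) \<longleftrightarrow> wf_fm L p"
  by (induction vs) (auto simp: Exs_def)

lemma sat_Exs_I:
  "sat M \<tau> p \<Longrightarrow> range \<tau> \<subseteq> universe M \<Longrightarrow> (\<And>v. v \<in> fv_fm p - set vs \<Longrightarrow> \<tau> v = \<sigma> v) \<Longrightarrow> sat M \<sigma> (Exs vs p)"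
proof (induction vs arbitrary: \<sigma>)
  case Nil
  then show ?case using sat_cong[of p \<tau> \<sigma> M] by (auto simp: Exs_def)
next
  case (Cons v vs)
  have "sat M (\<sigma>(v := \<tau> v)) (Exs vs p)"
    by (rule Cons.IH) (use Cons.prems in auto)
  then show ?case using Cons.prems(2) by (auto simp: Exs_def)
qed

lemma sat_Exs_D:
  "sat M \<sigma> (Exs vs p) \<Longrightarrow> range \<sigma> \<subseteq> universe M \<Longrightarrow> \<exists>\<tau>. range \<tau> \<subseteq> universe M \<and> sat M \<tau> p"
proof (induction vs arbitrary: \<sigma>)
  case Nil
  then show ?case by (auto simp: Exs_def)
next
  case (Cons v vs)
  then obtain a where "a \<in> universe M" "sat M (\<sigma>(v := a)) (Exs vs p)"
    by (auto simp: Exs_def)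
  then show ?case using Cons.IH[of "\<sigma>(v := a)"] Cons.prems(2) by fastforce
qed

definition fin_pattern ::
  "('f, 'r, 'a) fo_structure \<Rightarrow> nat \<Rightarrow> (nat \<Rightarrow> ('f, 'r) fm) \<Rightarrow> nat \<Rightarrow> (nat \<Rightarrow> nat \<Rightarrow> nat \<Rightarrow> 'a) \<Rightarrow> bool"
where
  "fin_pattern M n \<phi> m b \<longleftrightarrow> (\<forall>i j. range (b i j) \<subseteq> universe M) \<and>
     (\<forall>\<eta>. (\<forall>i<n. \<eta> i < m) \<longrightarrow>
       (\<exists>a\<in>universe M. \<forall>i<n. \<forall>j<m. sat M (env [a] (b i j)) (\<phi> i) \<longleftrightarrow> j = \<eta> i))"

definition slot :: "nat \<Rightarrow> nat \<Rightarrow> nat \<Rightarrow> nat" where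
  "slot i j k = (case k of 0 \<Rightarrow> 0 | Suc k \<Rightarrow> Suc (prod_encode (prod_encode (i, j), k)))"

lemma inj_slot: "inj (slot i j)"
  by (auto simp: inj_def slot_def split: nat.splits)

definition row_fm :: "nat \<Rightarrow> (nat \<Rightarrow> ('f, 'r) fm) \<Rightarrow> nat \<Rightarrow> nat list \<Rightarrow> ('f, 'r) fm" where
  "row_fm n \<phi> m \<eta> = Exists 0 (Conjs (map (\<lambda>(i, j).
      if j = \<eta> ! i then rn_fm (slot i j) (\<phi> i) else Neg (rn_fm (slot i j) (\<phi> i)))
      (List.product [0..<n] [0..<m])))"

definition pattern_fm :: "nat \<Rightarrow> (nat \<Rightarrow> ('f, 'r) fm) \<Rightarrow> nat \<Rightarrow> ('f, 'r) fm" where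
  "pattern_fm n \<phi> m = Conjs (map (row_fm n \<phi> m) (List.n_lists n [0..<m]))"

lemma wf_pattern_fm: "\<forall>i<n. wf_fm L (\<phi> i) \<Longrightarrow> wf_fm L (pattern_fm n \<phi> m)"
  by (auto simp: pattern_fm_def row_fm_def)

lemma sat_slot:
  "sat M (\<tau>(0 := a)) (rn_fm (slot i j) p) \<longleftrightarrow>
   sat M (env [a] (\<lambda>k. \<tau> (Suc (prod_encode (prod_encode (i, j), k))))) p"
proof -
  have "(\<tau>(0 := a)) \<circ> slot i j = env [a] (\<lambda>k. \<tau> (Suc (prod_encode (prod_encode (i, j), k))))"
    by (auto simp: fun_eq_iff env_def slot_def split: nat.splits)
  then show ?thesis by (simp add: sat_rn inj_slot)
qed

lemma sat_row_fm:
  assumes "universe M \<noteq> {}"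
  shows "sat M \<tau> (row_fm n \<phi> m \<eta>) \<longleftrightarrow> (\<exists>a\<in>universe M. \<forall>i<n. \<forall>j<m.
     sat M (env [a] (\<lambda>k. \<tau> (Suc (prod_encode (prod_encode (i, j), k))))) (\<phi> i) \<longleftrightarrow> j = \<eta> ! i)"
proof -
  have "sat M (\<tau>(0 := a)) (Conjs (map (\<lambda>(i, j).
      if j = \<eta> ! i then rn_fm (slot i j) (\<phi> i) else Neg (rn_fm (slot i j) (\<phi> i)))
      (List.product [0..<n] [0..<m]))) \<longleftrightarrow> (\<forall>i<n. \<forall>j<m.
     sat M (env [a] (\<lambda>k. \<tau> (Suc (prod_encode (prod_encode (i, j), k))))) (\<phi> i) \<longleftrightarrow> j = \<eta> ! i)"
    for a
    unfolding sat_Conjs[OF assms] sat_slot[symmetric]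
    by (fastforce simp: split: if_splits)
  then show ?thesis by (simp add: row_fm_def)
qed

lemma sat_pattern_fm:
  assumes "universe M \<noteq> {}"
  shows "sat M \<tau> (pattern_fm n \<phi> m) \<longleftrightarrow> (\<forall>\<eta>. (\<forall>i<n. \<eta> i < m) \<longrightarrow>
     (\<exists>a\<in>universe M. \<forall>i<n. \<forall>j<m.
        sat M (env [a] (\<lambda>k. \<tau> (Suc (prod_encode (prod_encode (i, j), k))))) (\<phi> i) \<longleftrightarrow> j = \<eta> i))"
    (is "_ \<longleftrightarrow> (\<forall>\<eta>. ?A \<eta> \<longrightarrow> ?P \<eta>)")
proof -
  have "sat M \<tau> (pattern_fm n \<phi> m) \<longleftrightarrow>
      (\<forall>\<eta>. length \<eta> = n \<and> set \<eta> \<subseteq> {0..<m} \<longrightarrow> ?P ((!) \<eta>))"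
    using assms by (simp add: pattern_fm_def set_n_lists sat_row_fm)
  also have "\<dots> \<longleftrightarrow> (\<forall>\<eta>. ?A \<eta> \<longrightarrow> ?P \<eta>)"
  proof (intro iffI allI impI)
    fix \<eta> :: "nat \<Rightarrow> nat"
    assume *: "\<forall>\<eta>. length \<eta> = n \<and> set \<eta> \<subseteq> {0..<m} \<longrightarrow> ?P ((!) \<eta>)" and "?A \<eta>"
    then have "?P ((!) (map \<eta> [0..<n]))" by (intro *[rule_format]) auto
    then show "?P \<eta>" by auto
  next
    fix \<eta> :: "nat list"
    assume *: "\<forall>\<eta>. ?A \<eta> \<longrightarrow> ?P \<eta>" and "length \<eta> = n \<and> set \<eta> \<subseteq> {0..<m}"
    then show "?P ((!) \<eta>)" by (intro *[rule_format]) (auto simp: subset_iff)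
  qed
  finally show ?thesis .
qed

lemma fin_pattern_transfer:
  assumes M: "is_structure L M" and E: "elementary_embedding L M h N"
    and wf: "\<forall>i<n. wf_fm L (\<phi> i)" and b: "fin_pattern N n \<phi> m b"
  shows "\<exists>b. fin_pattern M n \<phi> m b"
proof -
  obtain c where c: "c \<in> universe M" using M by (auto simp: is_structure_def)
  have hc: "h c \<in> universe N" using E c by (auto simp: elementary_embedding_def)
  define vs where "vs = sorted_list_of_set (fv_fm (pattern_fm n \<phi> m))"
  define S where "S = Exs vs (pattern_fm n \<phi> m)"
  have vs: "set vs = fv_fm (pattern_fm n \<phi> m)"
    by (simp add: vs_def finite_fv_fm)
  define \<tau> where "\<tau> v = (case v of 0 \<Rightarrow> h c | Suc u \<Rightarrow>
      let (e, k) = prod_decode u; (i, j) = prod_decode e in b i j k)" for v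
  have [simp]: "\<tau> (Suc (prod_encode (prod_encode (i, j), k))) = b i j k" for i j k
    by (simp add: \<tau>_def)
  have "range \<tau> \<subseteq> universe N"
    using b hc by (auto simp: \<tau>_def fin_pattern_def image_subset_iff split: nat.splits prod.splits)
  moreover have "sat N \<tau> (pattern_fm n \<phi> m)"
    using b hc by (subst sat_pattern_fm) (auto simp: fin_pattern_def)
  ultimately have "sat N (h \<circ> (\<lambda>_. c)) S"
    unfolding S_def by (intro sat_Exs_I[of N \<tau>]) (auto simp: vs)
  then have "sat M (\<lambda>_. c) S"
    using E c wf by (subst (asm) elementary_embedding_def) (auto simp: S_def wf_pattern_fm)
  then obtain \<upsilon> where "range \<upsilon> \<subseteq> universe M" "sat M \<upsilon> (pattern_fm n \<phi> m)"
    unfolding S_def using sat_Exs_D c by (metis image_subsetI)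
  then show ?thesis using c
    by (subst (asm) sat_pattern_fm)
       (auto simp: fin_pattern_def intro!: exI[of _ "\<lambda>i j k. \<upsilon> (Suc (prod_encode (prod_encode (i, j), k)))"])
qed

lemma has_ict_pattern_imp_fin:
  assumes N: "universe N \<noteq> {}" and "has_ict_pattern L N n"
  shows "\<exists>\<phi>. (\<forall>i<n. wf_fm L (\<phi> i)) \<and> (\<forall>m. \<exists>b. fin_pattern N n \<phi> m b)"
proof -
  obtain c where c: "c \<in> universe N" using N by auto
  from assms(2) obtain \<phi> b where *: "\<forall>i<n. wf_fm L (\<phi> i)"
    "\<forall>i<n. \<forall>j. range (b i j) \<subseteq> universe N"
    "\<forall>\<eta> :: nat \<Rightarrow> nat. \<exists>a\<in>universe N. \<forall>i<n. \<forall>j. sat N (env [a] (b i j)) (\<phi> i) \<longleftrightarrow> j = \<eta> i"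
    unfolding has_ict_pattern_def by blast
  have "fin_pattern N n \<phi> m (\<lambda>i. if i < n then b i else (\<lambda>_ _. c))" for m
    unfolding fin_pattern_def
  proof (intro conjI allI impI)
    show "range ((if i < n then b i else (\<lambda>_ _. c)) j) \<subseteq> universe N" for i j
      using *(2) c by auto
    show "\<exists>a\<in>universe N. \<forall>i<n. \<forall>j<m.
        sat N (env [a] ((if i < n then b i else (\<lambda>_ _. c)) j)) (\<phi> i) \<longleftrightarrow> j = \<eta> i" for \<eta>
      using *(3)[rule_format, of \<eta>] by (elim bexE, intro bexI) simp_all
  qed
  then show ?thesis using *(1) by blast
qed

text \<open>A nonprincipal ultrafilter on the natural numbers.\<close>

lemma ex_nonprincipal_ultrafilter:
  "\<exists>F :: nat filter. F \<noteq> bot \<and> F \<le> sequentially \<and> (\<forall>P. eventually P F \<or> eventually (\<lambda>k. \<not> P k) F)"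
proof -
  define \<A> where "\<A> = {C :: nat set set. \<forall>D\<subseteq>C. finite D \<longrightarrow> infinite (\<Inter>D)}"
  have "\<exists>M\<in>\<A>. \<forall>X\<in>\<A>. M \<subseteq> X \<longrightarrow> X = M"
  proof (rule subset_Zorn_nonempty)
    have "{} \<in> \<A>" by (simp add: \<A>_def)
    then show "\<A> \<noteq> {}" by blast
    fix \<C> assume \<C>: "\<C> \<noteq> {}" "subset.chain \<A> \<C>"
    have "infinite (\<Inter>D)" if D: "D \<subseteq> \<Union>\<C>" "finite D" for D
    proof -
      obtain C where "C \<in> \<C>" "D \<subseteq> C"
        using finite_subset_Union_chain[OF D(2,1) \<C>] by blast
      then show ?thesis using \<C>(2) D(2) by (auto simp: \<A>_def subset.chain_def)
    qed
    then show "\<Union>\<C> \<in> \<A>" by (simp add: \<A>_def)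
  qed
  then obtain M where M: "M \<in> \<A>" and max: "\<And>X. X \<in> \<A> \<Longrightarrow> M \<subseteq> X \<Longrightarrow> X = M" by blast
  have M_inf: "infinite (\<Inter>D)" if "D \<subseteq> M" "finite D" for D
    using M that by (auto simp: \<A>_def)
  have ext: "\<exists>D\<subseteq>M. finite D \<and> finite (\<Inter>D \<inter> B)" if "B \<notin> M" for B
  proof -
    have "insert B M \<notin> \<A>" using max[of "insert B M"] that by blast
    then obtain D where D: "D \<subseteq> insert B M" "finite D" "finite (\<Inter>D)"
      by (auto simp: \<A>_def)
    have "finite (\<Inter>(D - {B}) \<inter> B)"
      by (rule finite_subset[OF _ D(3)]) auto
    then show ?thesis using D by (intro exI[of _ "D - {B}"]) auto
  qed
  have ultra: "B \<in> M \<or> - B \<in> M" for B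
  proof (rule ccontr)
    assume "\<not> ?thesis"
    then obtain D E where D: "D \<subseteq> M" "finite D" "finite (\<Inter>D \<inter> B)"
      and E: "E \<subseteq> M" "finite E" "finite (\<Inter>E \<inter> - B)"
      using ext[of B] ext[of "- B"] by blast
    have "finite (\<Inter>(D \<union> E))"
      by (rule finite_subset[of _ "(\<Inter>D \<inter> B) \<union> (\<Inter>E \<inter> - B)"]) (use D E in auto)
    then show False using M_inf[of "D \<union> E"] D E by auto
  qed
  define F where "F = (INF A\<in>M. principal A)"
  have F: "eventually P F \<longleftrightarrow> (\<exists>D\<subseteq>M. finite D \<and> (\<forall>k\<in>\<Inter>D. P k))" for P :: "nat \<Rightarrow> bool"
  proof -
    have "(INF A\<in>D. principal A) = principal (\<Inter>D)" if "finite D" for D :: "nat set set"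
      using INF_principal_finite[OF that, of "\<lambda>A. A"] by simp
    then have "eventually P (INF A\<in>D. principal A) \<longleftrightarrow> (\<forall>k\<in>\<Inter>D. P k)" if "finite D" for D
      using that by (simp only: eventually_principal)
    then show ?thesis
      unfolding F_def eventually_INF[of P principal M] by blast
  qed
  have ev: "eventually P F" if "{k. P k} \<in> M" for P
    unfolding F using that by (intro exI[of _ "{{k. P k}}"]) auto
  have "F \<noteq> bot"
    unfolding trivial_limit_def F using M_inf by (metis ex_in_conv finite.emptyI)
  moreover have "eventually P F \<or> eventually (\<lambda>k. \<not> P k) F" for P
    using ultra[of "{k. P k}"] ev[of P] ev[of "\<lambda>k. \<not> P k"] by (auto simp: Collect_neg_eq)
  moreover have "F \<le> sequentially"
  proof (rule filter_leI)
    fix P :: "nat \<Rightarrow> bool" assume "eventually P sequentially"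
    then have "finite (- {k. P k})"
      by (simp add: cofinite_eq_sequentially[symmetric] eventually_cofinite Collect_neg_eq)
    then have "{k. P k} \<in> M"
      using ultra[of "{k. P k}"] M_inf[of "{- {k. P k}}"] by auto
    then show "eventually P F" by (rule ev)
  qed
  ultimately show ?thesis by blast
qed

locale ultrapower =
  fixes F :: "nat filter" and L :: "('f, 'r) language" and M :: "('f, 'r, 'a) fo_structure"
  assumes F_bot: "F \<noteq> bot" and F_seq: "F \<le> sequentially"
    and F_ultra: "eventually P F \<or> eventually (\<lambda>k. \<not> P k) F"
    and M: "is_structure L M"
begin

definition cls :: "(nat \<Rightarrow> 'a) \<Rightarrow> (nat \<Rightarrow> 'a) set" where
  "cls f = {g. range g \<subseteq> universe M \<and> eventually (\<lambda>k. f k = g k) F}"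

definition rep :: "(nat \<Rightarrow> 'a) set \<Rightarrow> nat \<Rightarrow> 'a" where
  "rep X = (SOME f. f \<in> X)"

definition N :: "('f, 'r, (nat \<Rightarrow> 'a) set) fo_structure" where
  "N = \<lparr>universe = cls ` {f. range f \<subseteq> universe M},
        fun_int = (\<lambda>g Xs. cls (\<lambda>k. fun_int M g (map (\<lambda>X. rep X k) Xs))),
        rel_int = (\<lambda>r Xs. eventually (\<lambda>k. rel_int M r (map (\<lambda>X. rep X k) Xs)) F)\<rparr>"

lemma eventually_neg: "eventually (\<lambda>k. \<not> P k) F \<longleftrightarrow> \<not> eventually P F"
  using F_ultra[of P] F_bot eventually_conj[of P F "\<lambda>k. \<not> P k"] by (auto simp: trivial_limit_def)

lemma cls_self: "range f \<subseteq> universe M \<Longrightarrow> f \<in> cls f"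
  by (simp add: cls_def)

lemma cls_eqI: "eventually (\<lambda>k. f k = g k) F \<Longrightarrow> cls f = cls g"
  unfolding cls_def by (auto elim: eventually_elim2)

lemma cls_eq_iff:
  "range f \<subseteq> universe M \<Longrightarrow> range g \<subseteq> universe M \<Longrightarrow> cls f = cls g \<longleftrightarrow> eventually (\<lambda>k. f k = g k) F"
  using cls_eqI[of f g] cls_self[of g] by (auto simp: cls_def)

lemma rep_cls:
  assumes "range f \<subseteq> universe M"
  shows "range (rep (cls f)) \<subseteq> universe M" "eventually (\<lambda>k. rep (cls f) k = f k) F"
proof -
  have "rep (cls f) \<in> cls f"
    unfolding rep_def by (rule someI[of _ f]) (simp add: cls_self assms)
  then show "range (rep (cls f)) \<subseteq> universe M" "eventually (\<lambda>k. rep (cls f) k = f k) F"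
    by (auto simp: cls_def eq_commute)
qed

lemma rep_univ:
  assumes "X \<in> universe N"
  shows "rep X k \<in> universe M"
proof -
  obtain f where "range f \<subseteq> universe M" "X = cls f"
    using assms by (auto simp: N_def)
  then show ?thesis using rep_cls(1)[of f] by blast
qed

lemma structure_N: "is_structure L N"
  unfolding is_structure_def
proof (intro conjI allI impI)
  show "universe N \<noteq> {}"
    using M by (auto simp: N_def is_structure_def)
  fix f Xs assume *: "fun_arity L f = Some (length Xs) \<and> set Xs \<subseteq> universe N"
  have "set (map (\<lambda>X. rep X k) Xs) \<subseteq> universe M" for k
    using * rep_univ by auto
  then have "fun_int M f (map (\<lambda>X. rep X k) Xs) \<in> universe M" for k
    using M * unfolding is_structure_def by (metis length_map)
  then show "fun_int N f Xs \<in> universe N"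
    by (auto simp: N_def)
qed

lemma trm_val_univ: "wf_trm L t \<Longrightarrow> range \<sigma> \<subseteq> universe M \<Longrightarrow> trm_val M \<sigma> t \<in> universe M"
proof (induction t)
  case (App f ts)
  then have "set (map (trm_val M \<sigma>) ts) \<subseteq> universe M" by auto
  then show ?case using App.prems M unfolding is_structure_def by auto
qed auto

lemma rep_map:
  assumes "\<And>t. t \<in> set ts \<Longrightarrow> range (g t) \<subseteq> universe M"
  shows "eventually (\<lambda>k. map (\<lambda>X. rep X k) (map (\<lambda>t. cls (g t)) ts) = map (\<lambda>t. g t k) ts) F"
  using assms
proof (induction ts)
  case (Cons t ts)
  then have "eventually (\<lambda>k. rep (cls (g t)) k = g t k) F" by (intro rep_cls) auto
  with Cons show ?case by (auto elim: eventually_elim2)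
qed simp

lemma trm_val_N:
  assumes "\<And>v. range (\<sigma> v) \<subseteq> universe M" and "wf_trm L t"
  shows "trm_val N (\<lambda>v. cls (\<sigma> v)) t = cls (\<lambda>k. trm_val M (\<lambda>v. \<sigma> v k) t)"
  using assms(2)
proof (induction t)
  case (App f ts)
  have r: "range (\<lambda>k. trm_val M (\<lambda>v. \<sigma> v k) t) \<subseteq> universe M" if "t \<in> set ts" for t
  proof -
    have "trm_val M (\<lambda>v. \<sigma> v k) t \<in> universe M" for k
      using assms(1) App.prems that by (intro trm_val_univ) auto
    then show ?thesis by auto
  qed
  have "map (trm_val N (\<lambda>v. cls (\<sigma> v))) ts = map (\<lambda>t. cls (\<lambda>k. trm_val M (\<lambda>v. \<sigma> v k) t)) ts"
    using App by auto
  then have "trm_val N (\<lambda>v. cls (\<sigma> v)) (App f ts) = cls (\<lambda>k. fun_int M f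
      (map (\<lambda>X. rep X k) (map (\<lambda>t. cls (\<lambda>k. trm_val M (\<lambda>v. \<sigma> v k) t)) ts)))"
    by (simp add: N_def del: map_map map_eq_conv)
  also have "\<dots> = cls (\<lambda>k. fun_int M f (map (\<lambda>t. trm_val M (\<lambda>v. \<sigma> v k) t) ts))"
    by (rule cls_eqI, rule eventually_mono[OF rep_map]) (use r in \<open>auto simp del: map_map map_eq_conv\<close>)
  finally show ?case by simp
qed simp

lemma los:
  assumes "\<And>v. range (\<sigma> v) \<subseteq> universe M" and "wf_fm L p"
  shows "sat N (\<lambda>v. cls (\<sigma> v)) p \<longleftrightarrow> eventually (\<lambda>k. sat M (\<lambda>v. \<sigma> v k) p) F"
  using assms
proof (induction p arbitrary: \<sigma>)
  case (Equal s t)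
  have "range (\<lambda>k. trm_val M (\<lambda>v. \<sigma> v k) u) \<subseteq> universe M" if "wf_trm L u" for u
    using Equal.prems(1) that by (auto intro!: trm_val_univ)
  then show ?case using Equal.prems by (simp add: trm_val_N cls_eq_iff)
next
  case (Pred r ts)
  have r: "range (\<lambda>k. trm_val M (\<lambda>v. \<sigma> v k) t) \<subseteq> universe M" if "t \<in> set ts" for t
    using Pred.prems that by (auto intro!: trm_val_univ)
  have "map (trm_val N (\<lambda>v. cls (\<sigma> v))) ts = map (\<lambda>t. cls (\<lambda>k. trm_val M (\<lambda>v. \<sigma> v k) t)) ts"
    using Pred.prems by (auto intro!: trm_val_N)
  then have "sat N (\<lambda>v. cls (\<sigma> v)) (Pred r ts) \<longleftrightarrow> eventually (\<lambda>k. rel_int M r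
      (map (\<lambda>X. rep X k) (map (\<lambda>t. cls (\<lambda>k. trm_val M (\<lambda>v. \<sigma> v k) t)) ts))) F"
    by (simp add: N_def del: map_map map_eq_conv)
  also have "\<dots> \<longleftrightarrow> eventually (\<lambda>k. rel_int M r (map (\<lambda>t. trm_val M (\<lambda>v. \<sigma> v k) t) ts)) F"
    by (rule eventually_subst, rule eventually_mono[OF rep_map])
       (use r in \<open>auto simp del: map_map map_eq_conv\<close>)
  finally show ?case by simp
next
  case (Neg p)
  then show ?case by (simp add: eventually_neg)
next
  case (Conj p q)
  then show ?case by (simp add: eventually_conj_iff)
next
  case (Exists v p)
  have upd: "(\<lambda>u. cls (\<sigma> u))(v := cls f) = (\<lambda>u. cls ((\<sigma>(v := f)) u))"
    "(\<lambda>u. (\<sigma>(v := f)) u k) = (\<lambda>u. \<sigma> u k)(v := f k)" for f k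
    by (simp_all add: fun_eq_iff)
  have IH: "sat N ((\<lambda>u. cls (\<sigma> u))(v := cls f)) p \<longleftrightarrow>
      eventually (\<lambda>k. sat M ((\<lambda>u. \<sigma> u k)(v := f k)) p) F" if "range f \<subseteq> universe M" for f
    unfolding upd(1) using Exists.IH[of "\<sigma>(v := f)"] Exists.prems that
    unfolding upd(2) by auto
  have "sat N (\<lambda>u. cls (\<sigma> u)) (Exists v p) \<longleftrightarrow>
      (\<exists>f. range f \<subseteq> universe M \<and> eventually (\<lambda>k. sat M ((\<lambda>u. \<sigma> u k)(v := f k)) p) F)"
    using IH by (auto simp: N_def)
  also have "\<dots> \<longleftrightarrow> eventually (\<lambda>k. \<exists>a\<in>universe M. sat M ((\<lambda>u. \<sigma> u k)(v := a)) p) F"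
  proof
    assume "\<exists>f. range f \<subseteq> universe M \<and> eventually (\<lambda>k. sat M ((\<lambda>u. \<sigma> u k)(v := f k)) p) F"
    then show "eventually (\<lambda>k. \<exists>a\<in>universe M. sat M ((\<lambda>u. \<sigma> u k)(v := a)) p) F"
      by (auto elim!: eventually_mono)
  next
    assume *: "eventually (\<lambda>k. \<exists>a\<in>universe M. sat M ((\<lambda>u. \<sigma> u k)(v := a)) p) F"
    have "\<exists>a. a \<in> universe M \<and>
        ((\<exists>a\<in>universe M. sat M ((\<lambda>u. \<sigma> u k)(v := a)) p) \<longrightarrow> sat M ((\<lambda>u. \<sigma> u k)(v := a)) p)" for k
      using M unfolding is_structure_def by blast
    then obtain f where f: "\<And>k. f k \<in> universe M" "\<And>k. (\<exists>a\<in>universe M. sat M ((\<lambda>u. \<sigma> u k)(v := a)) p) \<Longrightarrow>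
        sat M ((\<lambda>u. \<sigma> u k)(v := f k)) p"
      by metis
    then show "\<exists>f. range f \<subseteq> universe M \<and> eventually (\<lambda>k. sat M ((\<lambda>u. \<sigma> u k)(v := f k)) p) F"
      using * by (intro exI[of _ f]) (auto elim!: eventually_mono)
  qed
  finally show ?case by simp
qed

lemma elementary_N: "elementary_embedding L M (\<lambda>a. cls (\<lambda>_. a)) N"
proof -
  have "sat N (\<lambda>v. cls (\<lambda>_. \<sigma> v)) p \<longleftrightarrow> sat M \<sigma> p" if "wf_fm L p" "range \<sigma> \<subseteq> universe M" for p \<sigma>
    using los[of "\<lambda>v _. \<sigma> v" p] that F_bot by auto
  then show ?thesis
    by (auto simp: elementary_embedding_def o_def N_def)
qed

lemma pattern_N:
  assumes wf: "\<forall>i<n. wf_fm L (\<phi> i)" and fin: "\<And>m. \<exists>b. fin_pattern M n \<phi> m b"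
  shows "has_ict_pattern L N n"
proof -
  obtain b where b: "\<And>m. fin_pattern M n \<phi> m (b m)" using fin by metis
  have b_univ: "b m i j k \<in> universe M" for m i j k
    using b[of m] unfolding fin_pattern_def by (meson rangeI subsetD)
  obtain c where c: "c \<in> universe M" using M by (auto simp: is_structure_def)
  have "\<exists>a\<in>universe N. \<forall>i<n. \<forall>j. sat N (env [a] (\<lambda>k. cls (\<lambda>m. b m i j k))) (\<phi> i) \<longleftrightarrow> j = \<eta> i"
    for \<eta> :: "nat \<Rightarrow> nat"
  proof -
    have "\<exists>a\<in>universe M. (\<forall>i<n. \<eta> i < m) \<longrightarrow>
        (\<forall>i<n. \<forall>j<m. sat M (env [a] (b m i j)) (\<phi> i) \<longleftrightarrow> j = \<eta> i)" for m
      using b[of m] c unfolding fin_pattern_def by blast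
    then obtain a where a: "\<And>m. a m \<in> universe M"
      "\<And>m. (\<forall>i<n. \<eta> i < m) \<Longrightarrow> \<forall>i<n. \<forall>j<m. sat M (env [a m] (b m i j)) (\<phi> i) \<longleftrightarrow> j = \<eta> i"
      by metis
    have "sat N (env [cls a] (\<lambda>k. cls (\<lambda>m. b m i j k))) (\<phi> i) \<longleftrightarrow> j = \<eta> i" if i: "i < n" for i j
    proof -
      define \<sigma> where "\<sigma> v = (\<lambda>m. env [a m] (b m i j) v)" for v
      have \<sigma>: "env [cls a] (\<lambda>k. cls (\<lambda>m. b m i j k)) = (\<lambda>v. cls (\<sigma> v))"
        by (auto simp: env_def \<sigma>_def fun_eq_iff)
      have "sat N (\<lambda>v. cls (\<sigma> v)) (\<phi> i) \<longleftrightarrow> eventually (\<lambda>m. sat M (\<lambda>v. \<sigma> v m) (\<phi> i)) F"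
        using a(1) b_univ wf i by (intro los) (auto simp: \<sigma>_def env_def)
      also have "\<dots> \<longleftrightarrow> eventually (\<lambda>m. j = \<eta> i) F"
      proof (rule eventually_subst)
        have "eventually (\<lambda>m. m > j \<and> (\<forall>i\<in>{..<n}. m > \<eta> i)) sequentially"
          by (intro eventually_conj eventually_ball_finite ballI eventually_gt_at_top) auto
        then have "eventually (\<lambda>m. m > j \<and> (\<forall>i\<in>{..<n}. m > \<eta> i)) F"
          using F_seq filter_leD by blast
        then show "eventually (\<lambda>m. sat M (\<lambda>v. \<sigma> v m) (\<phi> i) = (j = \<eta> i)) F"
          by (rule eventually_mono) (use a(2) i in \<open>auto simp: \<sigma>_def\<close>)
      qed
      finally show ?thesis using F_bot by (simp add: \<sigma>)
    qed
    moreover have "cls a \<in> universe N" using a(1) by (auto simp: N_def)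
    ultimately show ?thesis by blast
  qed
  moreover have "range (\<lambda>k. cls (\<lambda>m. b m i j k)) \<subseteq> universe N" for i j
    using b_univ by (auto simp: N_def)
  ultimately show ?thesis using wf unfolding has_ict_pattern_def
    by (intro exI[of _ \<phi>] exI[of _ "\<lambda>i j k. cls (\<lambda>m. b m i j k)"]) blast
qed

end

lemma dp_rank_ge_if_fin_patterns:
  assumes "is_structure L M" and "\<forall>i<n. wf_fm L (\<phi> i)" and "\<And>m. \<exists>b. fin_pattern M n \<phi> m b"
  shows "dp_rank_ge L M n"
proof -
  obtain F :: "nat filter" where "F \<noteq> bot" "F \<le> sequentially"
    "\<forall>P. eventually P F \<or> eventually (\<lambda>k. \<not> P k) F"
    using ex_nonprincipal_ultrafilter by blast
  then interpret ultrapower F L M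
    using assms(1) by unfold_locales auto
  show ?thesis
    unfolding dp_rank_ge_def using structure_N elementary_N pattern_N[OF assms(2,3)] by blast
qed

lemma dp_rank_geI:
  fixes M :: "('f, 'r, 'a) fo_structure" and N :: "('f, 'r, 'b) fo_structure"
  assumes "is_structure L M" and "is_structure L N" and "elementary_embedding L M h N"
    and "has_ict_pattern L N n"
  shows "dp_rank_ge L M n"
proof -
  obtain \<phi> where "\<forall>i<n. wf_fm L (\<phi> i)" "\<forall>m. \<exists>b. fin_pattern N n \<phi> m b"
    using has_ict_pattern_imp_fin assms(2,4) unfolding is_structure_def by metis
  then show ?thesis
    using dp_rank_ge_if_fin_patterns fin_pattern_transfer assms(1,3) by metis
qed

end

theory Submission
  imports Defs
begin

text \<open>
  If the dp-rank is at most \<open>n\<close>, then for any \<open>n + 1\<close> uniformly definable families there is an \<open>m\<close>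
  such that no rows of \<open>m\<close> sets, one row from each family, form a pattern, in which
  every choice of one set per row is realised by a point in the chosen sets and in no others
  (\<open>dp_rank_ge_if_shattered\<close>). In a field the additive group turns ``independent'' scaled
  neighbourhoods of zero into such patterns: the rows consist of translates, and the realising
  points are sums with one summand per row. This is used twice.

  Local boundedness (\<open>locally_bounded_if_not_dp_rank_ge\<close>). If no neighbourhood of zero is
  bounded, then for any finitely many neighbourhoods \<open>V\<^sub>0, \<dots>, V\<^sub>i\<^sub>-\<^sub>1\<close> there is a
  neighbourhood \<open>W\<^sub>i\<close> such that no scaling of \<open>W\<^sub>i\<close> covers an intersection \<open>a\<^sub>0 V\<^sub>0 \<inter> \<dots> \<inter> a\<^sub>i\<^sub>-\<^sub>1 V\<^sub>i\<^sub>-\<^sub>1\<close>, even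
  up to finitely many translates (\<open>unbounded_not_finitely_covered\<close>, \<open>not_locally_bounded_step\<close>). Let \<open>B\<^sub>i\<close> be a basic
  neighbourhood with \<open>B\<^sub>i - B\<^sub>i \<subseteq> W\<^sub>i\<close>, and \<open>V\<^sub>i\<close> one whose \<open>n\<close>-fold sums lie in \<open>B\<^sub>i\<close>. Now fix \<open>m\<close>. In
  turn for \<open>i = 0, \<dots>, n\<close>, choose the scalar \<open>a\<^sub>i\<close> so large that \<open>a\<^sub>i V\<^sub>i\<close> contains all points chosen
  before, and then \<open>m\<close> points \<open>b\<^sub>i\<^sub>,\<^sub>k\<close> in the intersection of the earlier \<open>a\<^sub>j V\<^sub>j\<close> with pairwise
  differences outside \<open>a\<^sub>i W\<^sub>i\<close>. The sets \<open>b\<^sub>i\<^sub>,\<^sub>k + a\<^sub>i B\<^sub>i\<close> form a pattern: a sum with one of the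
  points from each row differs from its summand in row \<open>i\<close> by an element of \<open>a\<^sub>i B\<^sub>i\<close>, because all other
  summands lie in \<open>a\<^sub>i V\<^sub>i\<close>.

  The bounded \<open>W\<^sub>n\<close>-set (\<open>W_set_ratios\<close>). Let \<open>U\<close> be a bounded basic neighbourhood of zero, and
  take \<open>m\<close> distinct points \<open>b\<^sub>k\<close> of it. The union \<open>X\<close> of the sets \<open>(U - U) / (b\<^sub>k - b\<^sub>l)\<close> is bounded.
  If \<open>a\<^sub>0, \<dots>, a\<^sub>n\<close> witness that \<open>X\<close> is not a \<open>W\<^sub>n\<close>-set, then the sets \<open>a\<^sub>i b\<^sub>k + \<Sum>\<^sub>j a\<^sub>j U\<close>, with \<open>j\<close>
  different from \<open>i\<close>, form a pattern realised by the sums of \<open>a\<^sub>i b\<^sub>\<eta>\<^sub>(\<^sub>i\<^sub>)\<close>: a second set of row \<open>i\<close> through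
  such a sum would express \<open>a\<^sub>i\<close> as a combination of the others with coefficients in \<open>X\<close>. So \<open>X\<close> is
  a \<open>W\<^sub>n\<close>-set as soon as \<open>m\<close> is large. The families of sets in the pattern do not depend on \<open>m\<close>, which
  is why the bounded set \<open>U\<close>, and not the finite set of the \<open>b\<^sub>k\<close>, has to appear in them.
\<close>

section \<open>Uniform families and shattering\<close>

text \<open>
  One formula defines all members of the family as the parameters vary. The tuples of parameters
  that occur need not form a definable set, so subfamilies are again of this kind.
\<close>

definition def_family :: "('f, 'r) language \<Rightarrow> ('f, 'r, 'a) fo_structure \<Rightarrow> 'a set set \<Rightarrow> bool" where
  "def_family L K \<F> \<longleftrightarrow> (\<exists>\<phi>. wf_fm L \<phi> \<and>
     (\<forall>S\<in>\<F>. \<exists>\<sigma>. range \<sigma> \<subseteq> universe K \<and> S = {x \<in> universe K. sat K (env [x] \<sigma>) \<phi>}))"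

lemma def_family_mono: "def_family L K \<G> \<Longrightarrow> \<F> \<subseteq> \<G> \<Longrightarrow> def_family L K \<F>"
  unfolding def_family_def by blast

text \<open>
  The only access to dp-rank in what follows. By compactness, patterns of every finite length
  already in \<open>K\<close> suffice; the formulas are fixed by the families, and only the parameters depend on
  the length \<open>m\<close>.
\<close>

lemma dp_rank_ge_if_shattered:
  fixes K :: "('f, 'r, 'a) fo_structure"
  assumes K: "is_structure L K" and F: "\<And>i. i < n \<Longrightarrow> def_family L K (\<F> i)"
    and S: "\<And>m. \<exists>S. (\<forall>i<n. \<forall>k<m. S i k \<in> \<F> i) \<and> (\<forall>\<eta> :: nat \<Rightarrow> nat. (\<forall>i<n. \<eta> i < m) \<longrightarrow>
      (\<exists>x\<in>universe K. \<forall>i<n. \<forall>k<m. x \<in> S i k \<longleftrightarrow> k = \<eta> i))"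
  shows "dp_rank_ge L K n"
proof -
  let ?defines = "\<lambda>\<phi> \<sigma> S. range \<sigma> \<subseteq> universe K \<and> S = {x \<in> universe K. sat K (env [x] \<sigma>) \<phi>}"
  have "\<forall>i. \<exists>\<phi>. i < n \<longrightarrow> wf_fm L \<phi> \<and> (\<forall>S\<in>\<F> i. \<exists>\<sigma>. ?defines \<phi> \<sigma> S)"
    using F unfolding def_family_def by blast
  from choice[OF this] obtain \<phi> where \<phi>: "\<forall>i. i < n \<longrightarrow>
      wf_fm L (\<phi> i) \<and> (\<forall>S\<in>\<F> i. \<exists>\<sigma>. ?defines (\<phi> i) \<sigma> S)"
    by (elim exE)
  define p where "p i S = (SOME \<sigma>. ?defines (\<phi> i) \<sigma> S)" for i S
  have p: "range (p i S) \<subseteq> universe K" "S = {x \<in> universe K. sat K (env [x] (p i S)) (\<phi> i)}"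
    if "i < n" "S \<in> \<F> i" for i S
  proof -
    have "\<exists>\<sigma>. ?defines (\<phi> i) \<sigma> S" using \<phi> that by blast
    then have d: "?defines (\<phi> i) (p i S) S" unfolding p_def by (rule someI_ex)
    show "range (p i S) \<subseteq> universe K" "S = {x \<in> universe K. sat K (env [x] (p i S)) (\<phi> i)}"
      by (rule conjunct1[OF d], rule conjunct2[OF d])
  qed
  obtain c where c: "c \<in> universe K" using K by (auto simp: is_structure_def)
  have "\<exists>b. fin_pattern K n \<phi> m b" for m
  proof -
    obtain S where S1: "\<And>i k. i < n \<Longrightarrow> k < m \<Longrightarrow> S i k \<in> \<F> i"
      and S2: "\<And>\<eta> :: nat \<Rightarrow> nat. (\<forall>i<n. \<eta> i < m) \<Longrightarrow>
        \<exists>x\<in>universe K. \<forall>i<n. \<forall>k<m. x \<in> S i k \<longleftrightarrow> k = \<eta> i"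
      using S[of m] by blast
    define b where "b i k = (if i < n \<and> S i k \<in> \<F> i then p i (S i k) else (\<lambda>_. c))" for i k
    have sat: "sat K (env [x] (b i k)) (\<phi> i) \<longleftrightarrow> x \<in> S i k"
      if "i < n" "k < m" "x \<in> universe K" for i k x
      using p(2)[OF that(1) S1[OF that(1,2)]] S1[OF that(1,2)] that(1,3) by (auto simp: b_def)
    have univ: "range (b i k) \<subseteq> universe K" for i k
      using p(1)[of i "S i k"] c by (auto simp: b_def)
    have "\<exists>x\<in>universe K. \<forall>i<n. \<forall>k<m. sat K (env [x] (b i k)) (\<phi> i) \<longleftrightarrow> k = \<eta> i"
      if "\<forall>i<n. \<eta> i < m" for \<eta>
      using S2[OF that] sat by (metis (no_types, lifting))
    then show ?thesis
      unfolding fin_pattern_def using univ by blast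
  qed
  then show ?thesis
    by (intro dp_rank_ge_if_fin_patterns[OF K]) (use \<phi> in auto)
qed

lemma def_family_singletons: "def_family L K {{a} | a. a \<in> universe K}"
  unfolding def_family_def
proof (intro exI[of _ "Equal (Var 0) (Var 1)"] conjI ballI)
  fix S assume "S \<in> {{a} | a. a \<in> universe K}"
  then obtain a where "S = {a}" "a \<in> universe K" by blast
  then show "\<exists>\<sigma>. range \<sigma> \<subseteq> universe K \<and> S = {x \<in> universe K. sat K (env [x] \<sigma>) (Equal (Var 0) (Var 1))}"
    by (intro exI[of _ "\<lambda>_. a"]) (auto simp: env_def)
qed simp

lemma def_family_uniformly_definable:
  assumes "universe K = UNIV" "uniformly_definable L K \<B>"
  shows "def_family L K \<B>"
proof -
  obtain m Y Z where YZ: "definable L K m Y" "definable L K (Suc m) Z"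
    and B: "\<B> = {{a. a # y \<in> Z} | y. y \<in> Y}"
    using assms(2) unfolding uniformly_definable_def by blast
  have Y: "length y = m" if "y \<in> Y" for y using YZ(1) that by (auto simp: definable_def)
  obtain \<phi> \<sigma> where wf: "wf_fm L \<phi>" and Z: "Z = {xs. length xs = Suc m \<and> sat K (env xs \<sigma>) \<phi>}"
    using YZ(2) assms(1) unfolding definable_def by auto
  have "env (a # y) \<sigma> = env [a] (env y \<sigma>)" for a y
    by (auto simp: env_def fun_eq_iff nth_Cons split: nat.splits)
  then show ?thesis
    unfolding def_family_def B Z using wf assms(1) Y by (intro exI[of _ \<phi>]) auto
qed

text \<open>
  The single closure property from which the families of translates, scalings and weighted sums
  of definable sets are all obtained.
\<close>

lemma def_family_combine:
  fixes K :: "('f, 'r, 'a::field) fo_structure"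
  assumes K: "field_expansion L K" and F: "def_family L K \<F>" and G: "def_family L K \<G>"
  shows "def_family L K {{c * s + t | s t. s \<in> S \<and> t \<in> T} | c S T. S \<in> \<F> \<and> T \<in> \<G>}"
proof -
  obtain p q where pq: "fun_arity L p = Some 2" "\<And>x y. fun_int K p [x, y] = x + y"
    "fun_arity L q = Some 2" "\<And>x y. fun_int K q [x, y] = x * y" and [simp]: "universe K = UNIV"
    using K unfolding field_expansion_def by blast
  obtain \<phi> where \<phi>: "wf_fm L \<phi>" "\<And>S. S \<in> \<F> \<Longrightarrow> \<exists>\<sigma>. S = {x. sat K (env [x] \<sigma>) \<phi>}"
    using F unfolding def_family_def by auto
  obtain \<psi> where \<psi>: "wf_fm L \<psi>" "\<And>S. S \<in> \<G> \<Longrightarrow> \<exists>\<sigma>. S = {x. sat K (env [x] \<sigma>) \<psi>}"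
    using G unfolding def_family_def by auto
  \<comment> \<open>Variable \<open>0\<close> is the element, \<open>1\<close> and \<open>2\<close> are bound for the elements of \<open>S\<close> and \<open>T\<close>,
    \<open>3\<close> is the scalar, and the even and odd variables from \<open>4\<close> on carry the parameters of \<open>S\<close>
    and of \<open>T\<close>.\<close>
  define \<rho> where "\<rho> v = (case v of 0 \<Rightarrow> 1 | Suc v \<Rightarrow> 2 * v + 4)" for v :: nat
  define \<rho>' where "\<rho>' v = (case v of 0 \<Rightarrow> 2 | Suc v \<Rightarrow> 2 * v + 5)" for v :: nat
  have inj: "inj \<rho>" "inj \<rho>'"
    by (auto simp: inj_def \<rho>_def \<rho>'_def split: nat.splits)
  define \<theta> where "\<theta> = Exists 1 (Exists 2 (Conj (Equal (Var 0) (App p [App q [Var 3, Var 1], Var 2]))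
    (Conj (rn_fm \<rho> \<phi>) (rn_fm \<rho>' \<psi>))))"
  have "wf_fm L \<theta>"
    using pq \<phi> \<psi> by (simp add: \<theta>_def)
  moreover have "\<exists>\<sigma>. {c * s + t | s t. s \<in> S \<and> t \<in> T} = {x. sat K (env [x] \<sigma>) \<theta>}"
    if ST: "S \<in> \<F>" "T \<in> \<G>" for c S T
  proof -
    obtain \<sigma> where S: "S = {x. sat K (env [x] \<sigma>) \<phi>}"
      using \<phi>(2)[OF ST(1)] by blast
    obtain \<upsilon> where T: "T = {x. sat K (env [x] \<upsilon>) \<psi>}"
      using \<psi>(2)[OF ST(2)] by blast
    \<comment> \<open>The parameter in place \<open>v\<close> is read as variable \<open>v + 1\<close>; the places \<open>0\<close> and \<open>1\<close> belong to the
      bound variables.\<close>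
    define d where "d v = (if v < 2 then 0 else if v = 2 then c
      else if odd v then \<sigma> ((v - 3) div 2) else \<upsilon> ((v - 4) div 2))" for v :: nat
    have "((env [x] d)(1 := y, 2 := z)) \<circ> \<rho> = env [y] \<sigma>"
      "((env [x] d)(1 := y, 2 := z)) \<circ> \<rho>' = env [z] \<upsilon>" for x y z
      by (auto simp: fun_eq_iff env_def \<rho>_def \<rho>'_def d_def split: nat.splits)
    then have "sat K (env [x] d) \<theta> \<longleftrightarrow> (\<exists>y z. x = c * y + z \<and> y \<in> S \<and> z \<in> T)" for x
      by (simp add: \<theta>_def pq sat_rn inj S T fun_upd_twist[of 1 2]) (simp add: env_def d_def)
    then show ?thesis by (intro exI[of _ d]) auto
  qed
  ultimately show ?thesis
    unfolding def_family_def by (intro exI[of _ \<theta>]) auto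
qed

lemma def_family_affine:
  fixes K :: "('f, 'r, 'a::field) fo_structure"
  assumes K: "field_expansion L K" and F: "def_family L K \<F>"
  shows "def_family L K {{b + c * s | s. s \<in> S} | b c S. S \<in> \<F>}"
proof (rule def_family_mono[OF def_family_combine[OF K F def_family_singletons]])
  show "{{b + c * s | s. s \<in> S} | b c S. S \<in> \<F>} \<subseteq>
      {{c * s + t | s t. s \<in> S \<and> t \<in> T} | c S T. S \<in> \<F> \<and> T \<in> {{a} | a. a \<in> universe K}}"
  proof clarify
    fix b c S assume "S \<in> \<F>"
    then show "\<exists>c' S' T. {b + c * s | s. s \<in> S} = {c' * s + t | s t. s \<in> S' \<and> t \<in> T} \<and>
        S' \<in> \<F> \<and> T \<in> {{a} | a. a \<in> universe K}"
      using K by (intro exI[of _ c] exI[of _ S] exI[of _ "{b}"])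
        (auto simp: field_expansion_def add.commute)
  qed
qed

lemma def_family_weighted_sums:
  fixes K :: "('f, 'r, 'a::field) fo_structure"
  assumes K: "field_expansion L K" and U: "def_family L K {U}" and "finite J"
  shows "def_family L K {{b + (\<Sum>j\<in>J. a j * u j) | u. \<forall>j\<in>J. u j \<in> U} | b a. True}"
  using \<open>finite J\<close>
proof (induction J)
  case empty
  show ?case
    by (rule def_family_mono[OF def_family_singletons]) (use K in \<open>auto simp: field_expansion_def\<close>)
next
  case (insert i J)
  let ?\<G> = "{{b + (\<Sum>j\<in>J. a j * u j) | u. \<forall>j\<in>J. u j \<in> U} | b a. True}"
  have "{b + (\<Sum>j\<in>insert i J. a j * u j) | u. \<forall>j\<in>insert i J. u j \<in> U} =
      {a i * s + t | s t. s \<in> U \<and> t \<in> {b + (\<Sum>j\<in>J. a j * u j) | u. \<forall>j\<in>J. u j \<in> U}}" for b a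
  proof (intro set_eqI iffI)
    fix x assume "x \<in> {b + (\<Sum>j\<in>insert i J. a j * u j) | u. \<forall>j\<in>insert i J. u j \<in> U}"
    then obtain u where u: "x = b + (\<Sum>j\<in>insert i J. a j * u j)" "\<forall>j\<in>insert i J. u j \<in> U" by blast
    then have "x = a i * u i + (b + (\<Sum>j\<in>J. a j * u j))"
      using insert.hyps by (simp add: algebra_simps)
    then show "x \<in> {a i * s + t | s t. s \<in> U \<and> t \<in> {b + (\<Sum>j\<in>J. a j * u j) | u. \<forall>j\<in>J. u j \<in> U}}"
      using u(2) by blast
  next
    fix x assume "x \<in> {a i * s + t | s t. s \<in> U \<and> t \<in> {b + (\<Sum>j\<in>J. a j * u j) | u. \<forall>j\<in>J. u j \<in> U}}"
    then obtain s u where u: "x = a i * s + (b + (\<Sum>j\<in>J. a j * u j))" "s \<in> U" "\<forall>j\<in>J. u j \<in> U"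
      by blast
    have "(\<Sum>j\<in>J. a j * (u(i := s)) j) = (\<Sum>j\<in>J. a j * u j)"
      by (rule sum.cong) (use insert.hyps in auto)
    then have "x = b + (\<Sum>j\<in>insert i J. a j * (u(i := s)) j)"
      using insert.hyps u(1) by (simp add: algebra_simps)
    moreover have "\<forall>j\<in>insert i J. (u(i := s)) j \<in> U" using u by auto
    ultimately show "x \<in> {b + (\<Sum>j\<in>insert i J. a j * u j) | u. \<forall>j\<in>insert i J. u j \<in> U}"
      by blast
  qed
  then show ?case
    by (intro def_family_mono[OF def_family_combine[OF K U insert.IH]]) blast
qed

section \<open>Neighbourhoods of zero and bounded sets\<close>

locale topological_field =
  fixes T :: "'a::field topology"
  assumes top: "field_topology T"
begin

abbreviation N where "N \<equiv> nbhd_zero T"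

lemma topspace [simp]: "topspace T = UNIV"
  using top by (simp add: field_topology_def)

lemma N_UNIV: "N UNIV"
  unfolding nbhd_zero_def using openin_topspace[of T] by auto

lemma N_Int: "N U \<Longrightarrow> N V \<Longrightarrow> N (U \<inter> V)"
  unfolding nbhd_zero_def by (meson IntI Int_mono openin_Int)

lemma N_INT: "finite I \<Longrightarrow> (\<And>i. i \<in> I \<Longrightarrow> N (U i)) \<Longrightarrow> N (\<Inter>i\<in>I. U i)"
  by (induction I rule: finite_induct) (auto intro: N_UNIV N_Int)

lemma continuous_pair:
  assumes "continuous_map (prod_topology T T) T (\<lambda>(x, y). f x y)" and "N U" and "f p q = 0"
  obtains A B where "openin T A" "openin T B" "p \<in> A" "q \<in> B" "\<And>x y. x \<in> A \<Longrightarrow> y \<in> B \<Longrightarrow> f x y \<in> U"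
proof -
  obtain V where V: "openin T V" "0 \<in> V" "V \<subseteq> U" using assms(2) by (auto simp: nbhd_zero_def)
  have "openin (prod_topology T T) {z \<in> topspace (prod_topology T T). (case z of (x, y) \<Rightarrow> f x y) \<in> V}"
    using openin_continuous_map_preimage[OF assms(1) V(1)] .
  then have "\<exists>A B. openin T A \<and> openin T B \<and> p \<in> A \<and> q \<in> B \<and>
      A \<times> B \<subseteq> {z \<in> topspace (prod_topology T T). (case z of (x, y) \<Rightarrow> f x y) \<in> V}"
    unfolding openin_prod_topology_alt using assms(3) V(2) by auto
  then obtain A B where AB: "openin T A" "openin T B" "p \<in> A" "q \<in> B"
      "A \<times> B \<subseteq> {z \<in> topspace (prod_topology T T). (case z of (x, y) \<Rightarrow> f x y) \<in> V}"
    by blast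
  have "f x y \<in> U" if "x \<in> A" "y \<in> B" for x y
    using AB(5) that V(3) by auto
  then show ?thesis by (rule that[OF AB(1-4)])
qed

lemma continuous_zero:
  assumes "continuous_map (prod_topology T T) T (\<lambda>(x, y). f x y)" and "N U" and "f 0 0 = 0"
  obtains V where "N V" "\<And>x y. x \<in> V \<Longrightarrow> y \<in> V \<Longrightarrow> f x y \<in> U"
proof -
  obtain A B where "openin T A" "openin T B" "0 \<in> A" "0 \<in> B" "\<And>x y. x \<in> A \<Longrightarrow> y \<in> B \<Longrightarrow> f x y \<in> U"
    using continuous_pair[OF assms] by blast
  then show ?thesis
    by (intro that[of "A \<inter> B"]) (auto simp: nbhd_zero_def)
qed

lemma N_add: assumes "N U" obtains V where "N V" "\<And>x y. x \<in> V \<Longrightarrow> y \<in> V \<Longrightarrow> x + y \<in> U"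
proof -
  have c: "continuous_map (prod_topology T T) T (\<lambda>(x, y). x + y)"
    using top by (simp add: field_topology_def)
  show ?thesis
    by (rule continuous_zero[OF c assms add_0_left]) (rule that)
qed

lemma N_diff: assumes "N U" obtains V where "N V" "\<And>x y. x \<in> V \<Longrightarrow> y \<in> V \<Longrightarrow> x - y \<in> U"
proof -
  have c: "continuous_map (prod_topology T T) T (\<lambda>(x, y). x - y)"
    using top by (simp add: field_topology_def)
  show ?thesis
    by (rule continuous_zero[OF c assms diff_0_right]) (rule that)
qed

lemma N_mult: assumes "N U" obtains V where "N V" "\<And>x y. x \<in> V \<Longrightarrow> y \<in> V \<Longrightarrow> x * y \<in> U"
proof -
  have c: "continuous_map (prod_topology T T) T (\<lambda>(x, y). x * y)"
    using top by (simp add: field_topology_def)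
  show ?thesis
    by (rule continuous_zero[OF c assms mult_zero_left]) (rule that)
qed

lemma N_scale: assumes "N U" obtains V where "N V" "\<And>x. x \<in> V \<Longrightarrow> c * x \<in> U"
proof -
  obtain A B where "openin T A" "openin T B" "c \<in> A" "0 \<in> B" "\<And>x y. x \<in> A \<Longrightarrow> y \<in> B \<Longrightarrow> x * y \<in> U"
    using continuous_pair[of "(*)" U c 0] assms top by (auto simp: field_topology_def)
  then show ?thesis
    by (intro that[of B]) (auto simp: nbhd_zero_def)
qed

text \<open>A field topology in which some point is isolated is discrete, by translation.\<close>

lemma N_nontrivial: assumes "N U" obtains x where "x \<in> U" "x \<noteq> 0"
proof -
  have "\<exists>x\<in>U. x \<noteq> 0"
  proof (rule ccontr)
    assume "\<not> ?thesis"
    then have U: "U \<subseteq> {0}" by auto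
    have "openin T {a}" for a
    proof -
      obtain A B where AB: "openin T A" "openin T B" "a \<in> A" "a \<in> B"
          "\<And>x y. x \<in> A \<Longrightarrow> y \<in> B \<Longrightarrow> x - y \<in> U"
        using continuous_pair[of "(-)" U a a] assms top by (auto simp: field_topology_def)
      then have "A = {a}" using U by fastforce
      then show ?thesis using AB by simp
    qed
    then have "T = discrete_topology UNIV"
      by (metis discrete_topology_unique topspace UNIV_I)
    then show False using top by (simp add: field_topology_def)
  qed
  then show ?thesis using that by blast
qed

text \<open>
  Read with the inverse of \<open>e\<close>, this says that every finite set lies in some scaling of \<open>U\<close>, which
  is how scalars are made ``small'' or ``large'' below although the field carries no norm.
\<close>

lemma small_multiplier:
  assumes "finite D" "N U"
  obtains e where "e \<noteq> 0" "\<And>d. d \<in> D \<Longrightarrow> e * d \<in> U"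
proof -
  have "\<exists>V. N V \<and> (\<forall>x\<in>V. d * x \<in> U)" for d
    using N_scale[OF assms(2)] by metis
  then obtain V where V: "\<And>d. N (V d)" "\<And>d x. x \<in> V d \<Longrightarrow> d * x \<in> U" by metis
  have "N (\<Inter>d\<in>D. V d)" using assms(1) V(1) by (intro N_INT)
  then obtain e where e: "e \<noteq> 0" "e \<in> (\<Inter>d\<in>D. V d)" using N_nontrivial by blast
  then have "e * d \<in> U" if "d \<in> D" for d
    using V(2)[of e d] that by (auto simp: mult.commute)
  then show ?thesis using that e(1) by blast
qed

lemma N_avoid: assumes "a \<noteq> 0" obtains U where "N U" "a \<notin> U"
proof -
  have "Hausdorff_space T" using top by (simp add: field_topology_def)
  then obtain U V where "openin T U" "openin T V" "0 \<in> U" "a \<in> V" "disjnt U V"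
    using assms unfolding Hausdorff_space_def by (metis UNIV_I topspace)
  then show ?thesis
    by (intro that[of U]) (auto simp: nbhd_zero_def disjnt_def)
qed

lemma N_infinite: assumes "N U" shows "infinite U"
proof
  assume fin: "finite U"
  have "\<exists>V. N V \<and> a \<notin> V" if "a \<in> U - {0}" for a using N_avoid that by blast
  then obtain V where V: "\<And>a. a \<in> U - {0} \<Longrightarrow> N (V a) \<and> a \<notin> V a" by metis
  have "N (U \<inter> (\<Inter>a\<in>U - {0}. V a))"
    using V fin assms by (intro N_Int N_INT) auto
  then obtain x where "x \<in> U \<inter> (\<Inter>a\<in>U - {0}. V a)" "x \<noteq> 0" using N_nontrivial by blast
  then show False using V by auto
qed

lemma N_sum:
  assumes "N U"
  shows "\<exists>V. N V \<and> (\<forall>(J :: 'b set) v. finite J \<and> card J \<le> n \<and> (\<forall>j\<in>J. v j \<in> V) \<longrightarrow> (\<Sum>j\<in>J. v j) \<in> U)"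
  using assms
proof (induction n arbitrary: U)
  case 0
  then have "0 \<in> U" by (auto simp: nbhd_zero_def)
  then show ?case using N_UNIV by (intro exI[of _ UNIV]) auto
next
  case (Suc n)
  obtain U' where U': "N U'" "\<And>x y. x \<in> U' \<Longrightarrow> y \<in> U' \<Longrightarrow> x + y \<in> U"
    using N_add[OF Suc.prems] by blast
  obtain V where V: "N V"
    "\<forall>(J :: 'b set) v. finite J \<and> card J \<le> n \<and> (\<forall>j\<in>J. v j \<in> V) \<longrightarrow> (\<Sum>j\<in>J. v j) \<in> U'"
    using Suc.IH[OF U'(1)] by (elim exE conjE)
  have "(\<Sum>j\<in>J. v j) \<in> U" if J: "finite J" "card J \<le> Suc n" "\<forall>j\<in>J. v j \<in> V \<inter> U'"
    for J :: "'b set" and v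
  proof (cases "J = {}")
    case True
    then show ?thesis using Suc.prems by (auto simp: nbhd_zero_def)
  next
    case False
    then obtain i where i: "i \<in> J" by blast
    have "(\<Sum>j\<in>J. v j) = v i + (\<Sum>j\<in>J - {i}. v j)" using i J(1) by (simp add: sum.remove)
    moreover have "(\<Sum>j\<in>J - {i}. v j) \<in> U'" using J i by (intro V(2)[rule_format]) auto
    ultimately show ?thesis using U'(2) J(3) i by auto
  qed
  then show ?case
    by (intro exI[of _ "V \<inter> U'"] conjI allI impI N_Int V(1) U'(1)) simp
qed

lemma bounded_subset: "bounded_set T B \<Longrightarrow> A \<subseteq> B \<Longrightarrow> bounded_set T A"
  unfolding bounded_set_def by (meson image_mono subset_trans)

lemma bounded_scale: assumes "bounded_set T A" "d \<noteq> 0" shows "bounded_set T ((\<lambda>x. d * x) ` A)"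
  unfolding bounded_set_def
proof (intro allI impI)
  fix U assume "N U"
  then obtain c where "c \<noteq> 0" "(\<lambda>x. c * x) ` A \<subseteq> U" using assms by (auto simp: bounded_set_def)
  then show "\<exists>c. c \<noteq> 0 \<and> (\<lambda>x. c * x) ` (\<lambda>x. d * x) ` A \<subseteq> U"
    using assms(2) by (intro exI[of _ "c / d"]) auto
qed

lemma bounded_diff: assumes "bounded_set T A" shows "bounded_set T {x - y | x y. x \<in> A \<and> y \<in> A}"
  unfolding bounded_set_def
proof (intro allI impI)
  fix U assume "N U"
  then obtain V where V: "N V" "\<And>x y. x \<in> V \<Longrightarrow> y \<in> V \<Longrightarrow> x - y \<in> U" using N_diff by blast
  then obtain c where "c \<noteq> 0" "(\<lambda>x. c * x) ` A \<subseteq> V" using assms by (auto simp: bounded_set_def)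
  then show "\<exists>c. c \<noteq> 0 \<and> (\<lambda>x. c * x) ` {x - y | x y. x \<in> A \<and> y \<in> A} \<subseteq> U"
    using V(2) by (intro exI[of _ c]) (auto simp: right_diff_distrib image_subset_iff)
qed

lemma bounded_UN:
  assumes "finite I" "\<And>i. i \<in> I \<Longrightarrow> bounded_set T (A i)"
  shows "bounded_set T (\<Union>i\<in>I. A i)"
  unfolding bounded_set_def
proof (intro allI impI)
  fix U assume "N U"
  then obtain V where V: "N V" "\<And>x y. x \<in> V \<Longrightarrow> y \<in> V \<Longrightarrow> x * y \<in> U" using N_mult by blast
  have "\<exists>c. c \<noteq> 0 \<and> (\<forall>x\<in>A i. c * x \<in> V)" if "i \<in> I" for i
    using assms(2)[OF that] V(1) unfolding bounded_set_def by blast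
  then obtain c where c: "\<And>i. i \<in> I \<Longrightarrow> c i \<noteq> 0" "\<And>i x. i \<in> I \<Longrightarrow> x \<in> A i \<Longrightarrow> c i * x \<in> V"
    by metis
  obtain e where e: "e \<noteq> 0" "\<And>d. d \<in> (\<lambda>i. inverse (c i)) ` I \<Longrightarrow> e * d \<in> V"
    using small_multiplier[of "(\<lambda>i. inverse (c i)) ` I" V] assms(1) V(1) by blast
  have "e * x \<in> U" if "i \<in> I" "x \<in> A i" for i x
  proof -
    have "(e * inverse (c i)) * (c i * x) \<in> U"
      using V(2) e(2) c(2) that by blast
    moreover have "(e * inverse (c i)) * (c i * x) = e * x"
      using c(1)[OF that(1)] by simp
    ultimately show ?thesis by simp
  qed
  then show "\<exists>c. c \<noteq> 0 \<and> (\<lambda>x. c * x) ` (\<Union>i\<in>I. A i) \<subseteq> U"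
    using e(1) by blast
qed

section \<open>Local boundedness\<close>

text \<open>
  Finitely many translates do not help to cover an unbounded set: if \<open>U \<subseteq> F + c W\<close>, multiply by \<open>e / c\<close>
  with \<open>e \<in> W\<close> so small that the finite set \<open>e F / c\<close> disappears in a given neighbourhood. The
  remaining part lies in \<open>e W \<subseteq> W W\<close>, which is small although \<open>W\<close> may be unbounded.
\<close>

lemma unbounded_not_finitely_covered:
  assumes "\<not> bounded_set T U"
  obtains W where "N W"
    "\<And>F c. finite F \<Longrightarrow> c \<noteq> 0 \<Longrightarrow> \<exists>u\<in>U. \<forall>f\<in>F. (u - f) / c \<notin> W"
proof -
  obtain W0 where W0: "N W0" "\<And>c. c \<noteq> 0 \<Longrightarrow> \<exists>u\<in>U. c * u \<notin> W0"
    using assms unfolding bounded_set_def by blast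
  obtain W1 where W1: "N W1" "\<And>x y. x \<in> W1 \<Longrightarrow> y \<in> W1 \<Longrightarrow> x + y \<in> W0"
    using N_add[OF W0(1)] by blast
  obtain W where W: "N W" "\<And>x y. x \<in> W \<Longrightarrow> y \<in> W \<Longrightarrow> x * y \<in> W1"
    using N_mult[OF W1(1)] by blast
  have "\<exists>u\<in>U. \<forall>f\<in>F. (u - f) / c \<notin> W" if F: "finite F" and c: "c \<noteq> 0" for F c
  proof (rule ccontr)
    assume "\<not> ?thesis"
    then have cover: "\<exists>f\<in>F. (u - f) / c \<in> W" if "u \<in> U" for u using that by blast
    obtain e where e: "e \<noteq> 0" "\<And>d. d \<in> insert 1 ((\<lambda>f. f / c) ` F) \<Longrightarrow> e * d \<in> W \<inter> W1"
      using small_multiplier[of "insert 1 ((\<lambda>f. f / c) ` F)" "W \<inter> W1"] F N_Int[OF W(1) W1(1)] by blast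
    obtain u where u: "u \<in> U" "(e / c) * u \<notin> W0" using W0(2)[of "e / c"] e(1) c by auto
    obtain f where f: "f \<in> F" "(u - f) / c \<in> W" using cover u(1) by blast
    have "e * (f / c) \<in> W1" "e * 1 \<in> W" using e(2) f(1) by blast+
    then have "e * (f / c) + e * ((u - f) / c) \<in> W0" using W1(2) W(2)[OF _ f(2)] by auto
    moreover have "e * (f / c) + e * ((u - f) / c) = (e / c) * u" using c by (simp add: field_simps)
    ultimately show False using u(2) by simp
  qed
  then show ?thesis using that W(1) by blast
qed

text \<open>
  \<open>W\<close> works for all scalars \<open>a\<close> at once: some neighbourhood \<open>U\<close>, which depends on the \<open>V j\<close> only, has
  a scaling inside each intersection of the sets \<open>a j * V j\<close>, namely by any small \<open>e\<close>, since
  \<open>U * U \<subseteq> V j\<close>. So it is enough to apply the previous lemma to \<open>U\<close>.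
\<close>

lemma not_locally_bounded_step:
  fixes i :: nat and V :: "nat \<Rightarrow> 'a set"
  assumes nb: "\<not> locally_bounded T" and V: "\<And>j. j < i \<Longrightarrow> N (V j)"
  obtains W where "N W"
    "\<And>a c F. (\<forall>j<i. a j \<noteq> 0) \<Longrightarrow> c \<noteq> 0 \<Longrightarrow> finite F \<Longrightarrow>
      \<exists>u. (\<forall>j<i. u / a j \<in> V j) \<and> (\<forall>f\<in>F. (u - f) / c \<notin> W \<and> (f - u) / c \<notin> W)"
proof -
  have "N (\<Inter>j\<in>{..<i}. V j)"
    using V by (intro N_INT) auto
  then obtain U where U: "N U" "\<And>x y. x \<in> U \<Longrightarrow> y \<in> U \<Longrightarrow> x * y \<in> (\<Inter>j\<in>{..<i}. V j)"
    using N_mult by blast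
  have "\<not> bounded_set T U" using nb U(1) by (auto simp: locally_bounded_def)
  then obtain W where W: "N W" "\<And>F c. finite F \<Longrightarrow> c \<noteq> 0 \<Longrightarrow> \<exists>u\<in>U. \<forall>f\<in>F. (u - f) / c \<notin> W"
    using unbounded_not_finitely_covered by blast
  \<comment> \<open>A neighbourhood inside \<open>- W\<close> takes care of the differences in the other order.\<close>
  obtain W' where W': "N W'" "\<And>x. x \<in> W' \<Longrightarrow> -1 * x \<in> W" using N_scale[OF W(1), of "-1"] by blast
  show ?thesis
  proof (rule that[OF N_Int[OF W(1) W'(1)]])
    fix a :: "nat \<Rightarrow> 'a" and c :: 'a and F :: "'a set"
    assume a: "\<forall>j<i. a j \<noteq> 0" and c: "c \<noteq> 0" and F: "finite F"
    obtain e where e: "e \<noteq> 0" "\<And>d. d \<in> (\<lambda>j. inverse (a j)) ` {..<i} \<Longrightarrow> e * d \<in> U"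
      using small_multiplier[of "(\<lambda>j. inverse (a j)) ` {..<i}" U] U(1) by blast
    obtain u where u: "u \<in> U" "\<forall>f\<in>(\<lambda>f. f / e) ` F. (u - f) / (c / e) \<notin> W"
      using W(2)[of "(\<lambda>f. f / e) ` F" "c / e"] F c e(1) by auto
    have "(e * u) / a j \<in> V j" if "j < i" for j
    proof -
      have "(e * inverse (a j)) * u \<in> V j" using U(2)[OF e(2) u(1)] that by blast
      then show ?thesis by (simp add: field_simps)
    qed
    moreover have not_W: "(e * u - f) / c \<notin> W" if "f \<in> F" for f
    proof -
      have "(u - f / e) / (c / e) = (e * u - f) / c" using e(1) c by (simp add: field_simps)
      then show ?thesis using u(2) that by auto
    qed
    moreover have "(f - e * u) / c \<notin> W'" if "f \<in> F" for f
    proof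
      assume "(f - e * u) / c \<in> W'"
      then have "-1 * ((f - e * u) / c) \<in> W" using W'(2) by blast
      moreover have "-1 * ((f - e * u) / c) = (e * u - f) / c"
        using c by (simp add: field_simps)
      ultimately show False using not_W that by metis
    qed
    ultimately show "\<exists>u. (\<forall>j<i. u / a j \<in> V j) \<and>
        (\<forall>f\<in>F. (u - f) / c \<notin> W \<inter> W' \<and> (f - u) / c \<notin> W \<inter> W')"
      by blast
  qed
qed

lemma separated_sequence:
  assumes "\<And>F :: 'a set. finite F \<Longrightarrow> \<exists>u. P u \<and> (\<forall>f\<in>F. R u f \<and> R f u)"
  shows "\<exists>g :: nat \<Rightarrow> 'a. (\<forall>l. P (g l)) \<and> (\<forall>l k. l \<noteq> k \<longrightarrow> R (g l) (g k))"
proof -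
  have "\<exists>g :: nat \<Rightarrow> 'a. \<forall>l. P (g l) \<and> (\<forall>k<l. R (g l) (g k) \<and> R (g k) (g l))"
  proof (rule dependent_wellorder_choice)
    fix l and g :: "nat \<Rightarrow> 'a"
    show "\<exists>u. P u \<and> (\<forall>k<l. R u (g k) \<and> R (g k) u)"
      using assms[of "g ` {..<l}"] by auto
  qed auto
  then show ?thesis by (metis nat_neq_iff)
qed

text \<open>
  The neighbourhoods of the pattern, before any scalars are chosen. Each \<open>W i\<close> is chosen
  with respect to the earlier \<open>V j\<close>; then \<open>B i\<close> and \<open>V i\<close> are shrunk so that a sum \<open>s\<close> of \<open>n\<close>
  elements of \<open>V i\<close> lies in \<open>B i\<close>, while \<open>w + s\<close> can lie in \<open>B i\<close> only if \<open>w\<close> lies in \<open>W i\<close>.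
\<close>

lemma unbounded_nbhd_sequence:
  assumes nb: "\<not> locally_bounded T" and \<B>: "\<forall>U. N U \<longrightarrow> (\<exists>B\<in>\<B>. N B \<and> B \<subseteq> U)"
  obtains V B W :: "nat \<Rightarrow> 'a set"
  where "\<And>i. N (V i)" "\<And>i. B i \<in> \<B>"
    "\<And>i (J :: nat set) v. finite J \<Longrightarrow> card J \<le> n \<Longrightarrow> (\<forall>j\<in>J. v j \<in> V i) \<Longrightarrow> (\<Sum>j\<in>J. v j) \<in> B i"
    "\<And>i x y. x \<in> B i \<Longrightarrow> y \<in> B i \<Longrightarrow> x - y \<in> W i"
    "\<And>i a c F. (\<forall>j<i. a j \<noteq> 0) \<Longrightarrow> c \<noteq> 0 \<Longrightarrow> finite F \<Longrightarrow>
      \<exists>u. (\<forall>j<i. u / a j \<in> V j) \<and> (\<forall>f\<in>F. (u - f) / c \<notin> W i \<and> (f - u) / c \<notin> W i)"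
proof -
  define P where "P V i X \<longleftrightarrow> (case X of (V', W, B) \<Rightarrow> N V' \<and> B \<in> \<B> \<and>
      (\<forall>(J :: nat set) v. finite J \<and> card J \<le> n \<and> (\<forall>j\<in>J. v j \<in> V') \<longrightarrow> (\<Sum>j\<in>J. v j) \<in> B) \<and>
      (\<forall>x\<in>B. \<forall>y\<in>B. x - y \<in> W) \<and>
      (\<forall>a c F. (\<forall>j<i. a j \<noteq> 0) \<and> c \<noteq> 0 \<and> finite F \<longrightarrow>
        (\<exists>u. (\<forall>j<i. u / a j \<in> fst (V j)) \<and> (\<forall>f\<in>F. (u - f) / c \<notin> W \<and> (f - u) / c \<notin> W))))"
    for V :: "nat \<Rightarrow> 'a set \<times> 'a set \<times> 'a set" and i X
  have "\<exists>V. \<forall>i. P V i (V i)"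
  proof (rule dependent_wellorder_choice)
    fix r and f g :: "nat \<Rightarrow> 'a set \<times> 'a set \<times> 'a set" and i
    assume "\<And>j. j < i \<Longrightarrow> f j = g j"
    then show "P f i r = P g i r"
      by (simp add: P_def cong: conj_cong split: prod.splits)
  next
    fix i and V assume IH: "\<And>j. j < i \<Longrightarrow> P V j (V j)"
    have "N (fst (V j))" if "j < i" for j using IH[OF that] by (auto simp: P_def)
    then obtain W where W: "N W" "\<And>a c F. (\<forall>j<i. a j \<noteq> 0) \<Longrightarrow> c \<noteq> 0 \<Longrightarrow> finite F \<Longrightarrow>
        \<exists>u. (\<forall>j<i. u / a j \<in> fst (V j)) \<and> (\<forall>f\<in>F. (u - f) / c \<notin> W \<and> (f - u) / c \<notin> W)"
      using not_locally_bounded_step[OF nb, of i "\<lambda>j. fst (V j)"] by blast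
    obtain U where U: "N U" "\<And>x y. x \<in> U \<Longrightarrow> y \<in> U \<Longrightarrow> x - y \<in> W" using N_diff[OF W(1)] by blast
    obtain B where B: "B \<in> \<B>" "N B" "B \<subseteq> U" using \<B> U(1) by blast
    obtain V' where V': "N V'"
      "\<forall>(J :: nat set) v. finite J \<and> card J \<le> n \<and> (\<forall>j\<in>J. v j \<in> V') \<longrightarrow> (\<Sum>j\<in>J. v j) \<in> B"
      using N_sum[OF B(2), of n] by (elim exE conjE)
    have "P V i (V', W, B)"
      unfolding P_def using V' B U(2) W(2) by (simp add: subset_iff)
    then show "\<exists>X. P V i X" by blast
  qed
  then obtain X where X: "\<And>i. P X i (X i)" by blast
  show ?thesis
    by (rule that[of "\<lambda>i. fst (X i)" "\<lambda>i. snd (snd (X i))" "\<lambda>i. fst (snd (X i))"])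
       (use X in \<open>simp_all add: P_def case_prod_unfold\<close>)
qed

text \<open>
  The sets \<open>b i k + a i * B i\<close> form a pattern with \<open>n + 1\<close> rows as soon as \<open>b j l\<close> lies in \<open>a i * V i\<close>
  for all \<open>j\<close> other than \<open>i\<close>, while distinct \<open>b i k\<close> do not differ by an element of \<open>a i * W i\<close>.
\<close>

lemma locally_bounded_if_not_dp_rank_ge:
  fixes K :: "('f, 'r, 'a) fo_structure"
  assumes K: "field_expansion L K" and \<B>: "\<forall>U. N U \<longrightarrow> (\<exists>B\<in>\<B>. N B \<and> B \<subseteq> U)"
    and F: "def_family L K \<B>" and rk: "\<not> dp_rank_ge L K (Suc n)"
  shows "locally_bounded T"
proof (rule ccontr)
  assume nb: "\<not> locally_bounded T"
  obtain V B W :: "nat \<Rightarrow> 'a set" where V: "\<And>i. N (V i)" and B: "\<And>i. B i \<in> \<B>"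
    and VB: "\<And>i (J :: nat set) v. finite J \<Longrightarrow> card J \<le> n \<Longrightarrow> (\<forall>j\<in>J. v j \<in> V i) \<Longrightarrow> (\<Sum>j\<in>J. v j) \<in> B i"
    and BW: "\<And>i x y. x \<in> B i \<Longrightarrow> y \<in> B i \<Longrightarrow> x - y \<in> W i"
    and W: "\<And>i a c F. (\<forall>j<i. a j \<noteq> 0) \<Longrightarrow> c \<noteq> 0 \<Longrightarrow> finite F \<Longrightarrow>
      \<exists>u. (\<forall>j<i. u / a j \<in> V j) \<and> (\<forall>f\<in>F. (u - f) / c \<notin> W i \<and> (f - u) / c \<notin> W i)"
    by (rule unbounded_nbhd_sequence[OF nb \<B>, where n = n]) (rule that; assumption)
  have "\<exists>S. (\<forall>i<Suc n. \<forall>k<m. S i k \<in> {{b + c * s | s. s \<in> S} | b c S. S \<in> \<B>}) \<and>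
      (\<forall>\<eta> :: nat \<Rightarrow> nat. (\<forall>i<Suc n. \<eta> i < m) \<longrightarrow>
        (\<exists>x\<in>universe K. \<forall>i<Suc n. \<forall>k<m. x \<in> S i k \<longleftrightarrow> k = \<eta> i))" for m
  proof -
    \<comment> \<open>Rows are chosen one after the other: the points of row \<open>i\<close> lie in the scaled neighbourhoods of
      the earlier rows, and the scalar of row \<open>i\<close> is large enough to catch the earlier points.\<close>
    define P where "P f i X \<longleftrightarrow> (case X of (c, g :: nat \<Rightarrow> 'a) \<Rightarrow> c \<noteq> 0 \<and>
        (\<forall>j<i. \<forall>l<m. snd (f j) l / c \<in> V i) \<and>
        (\<forall>l. \<forall>j<i. g l / fst (f j) \<in> V j) \<and> (\<forall>l k. l \<noteq> k \<longrightarrow> (g l - g k) / c \<notin> W i))"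
      for f :: "nat \<Rightarrow> 'a \<times> (nat \<Rightarrow> 'a)" and i X
    have "\<exists>f. \<forall>i. P f i (f i)"
    proof (rule dependent_wellorder_choice)
      fix r and f g :: "nat \<Rightarrow> 'a \<times> (nat \<Rightarrow> 'a)" and i
      assume "\<And>j. j < i \<Longrightarrow> f j = g j"
      then show "P f i r = P g i r"
        by (simp add: P_def split: prod.splits)
    next
      fix i and f assume IH: "\<And>j. j < i \<Longrightarrow> P f j (f j)"
      have nz: "\<forall>j<i. fst (f j) \<noteq> 0" using IH by (simp add: P_def case_prod_unfold)
      have "finite (\<Union>j\<in>{..<i}. snd (f j) ` {..<m})" by auto
      then obtain e where e: "e \<noteq> 0" "\<And>d. d \<in> (\<Union>j\<in>{..<i}. snd (f j) ` {..<m}) \<Longrightarrow> e * d \<in> V i"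
        using small_multiplier V by blast
      define c where "c = inverse e"
      have c: "c \<noteq> 0" using e(1) by (simp add: c_def)
      have in_V: "snd (f j) l / c \<in> V i" if "j < i" "l < m" for j l
        using e(2)[of "snd (f j) l"] that by (auto simp: c_def divide_inverse mult.commute)
      have "\<exists>u. (\<forall>j<i. u / fst (f j) \<in> V j) \<and> (\<forall>x\<in>F. (u - x) / c \<notin> W i \<and> (x - u) / c \<notin> W i)"
        if "finite F" for F
        using W[OF nz c that] .
      then obtain g :: "nat \<Rightarrow> 'a" where g: "\<forall>l. \<forall>j<i. g l / fst (f j) \<in> V j"
          "\<forall>l k. l \<noteq> k \<longrightarrow> (g l - g k) / c \<notin> W i"
        using separated_sequence[of "\<lambda>u. \<forall>j<i. u / fst (f j) \<in> V j" "\<lambda>u x. (u - x) / c \<notin> W i"]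
        by auto
      have "P f i (c, g)" unfolding P_def using c in_V g by simp
      then show "\<exists>X. P f i X" by blast
    qed
    then obtain f where f: "\<And>i. P f i (f i)" by blast
    define a where "a i = fst (f i)" for i
    define b where "b i = snd (f i)" for i
    have a: "a i \<noteq> 0" for i using f[of i] by (simp add: P_def a_def case_prod_unfold)
    have sep: "(b i l - b i k) / a i \<notin> W i" if "l \<noteq> k" for i k l
      using f[of i] that by (simp add: P_def a_def b_def case_prod_unfold)
    have "b j l / a i \<in> V i" if "j < i" "l < m" for i j l
      using f[of i] that by (simp add: P_def a_def b_def case_prod_unfold)
    moreover have "b j l / a i \<in> V i" if "i < j" "l < m" for i j l
      using f[of j] that by (simp add: P_def a_def b_def case_prod_unfold)
    ultimately have in_V: "b j l / a i \<in> V i" if "j \<noteq> i" "l < m" for i j l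
      using that by (meson nat_neq_iff)
    define S where "S i k = {b i k + a i * s | s. s \<in> B i}" for i k
    have S: "x \<in> S i k \<longleftrightarrow> (x - b i k) / a i \<in> B i" for x i k
    proof
      assume "(x - b i k) / a i \<in> B i"
      moreover have "x = b i k + a i * ((x - b i k) / a i)" using a[of i] by simp
      ultimately show "x \<in> S i k" unfolding S_def by blast
    qed (use a[of i] in \<open>auto simp: S_def\<close>)
    have "(\<Sum>j<Suc n. b j (\<eta> j)) \<in> S i k \<longleftrightarrow> k = \<eta> i"
      if \<eta>: "\<forall>i<Suc n. \<eta> i < m" and i: "i < Suc n" and k: "k < m" for \<eta> i k
    proof -
      define s where "s = (\<Sum>j\<in>{..<Suc n} - {i}. b j (\<eta> j) / a i)"
      have s: "s \<in> B i"
        unfolding s_def using i in_V \<eta> by (intro VB) auto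
      have eq: "((\<Sum>j<Suc n. b j (\<eta> j)) - b i k) / a i = s + (b i (\<eta> i) - b i k) / a i"
        using i by (subst sum.remove[of _ i]) (auto simp: s_def add_divide_distrib diff_divide_distrib sum_divide_distrib)
      have mem: "(\<Sum>j<Suc n. b j (\<eta> j)) \<in> S i k \<longleftrightarrow> s + (b i (\<eta> i) - b i k) / a i \<in> B i"
        by (simp only: S eq)
      show ?thesis
      proof
        assume "(\<Sum>j<Suc n. b j (\<eta> j)) \<in> S i k"
        then have "s + (b i (\<eta> i) - b i k) / a i - s \<in> W i"
          using BW s by (simp only: mem)
        then show "k = \<eta> i" using sep[of "\<eta> i" k i] by auto
      next
        assume "k = \<eta> i"
        then show "(\<Sum>j<Suc n. b j (\<eta> j)) \<in> S i k" unfolding mem using s by simp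
      qed
    qed
    moreover have "S i k \<in> {{b + c * s | s. s \<in> S} | b c S. S \<in> \<B>}" for i k
      unfolding S_def using B by blast
    moreover have "universe K = UNIV" using K by (simp add: field_expansion_def)
    ultimately show ?thesis by (intro exI[of _ S]) auto
  qed
  then have "dp_rank_ge L K (Suc n)"
    using K by (intro dp_rank_ge_if_shattered[where \<F> = "\<lambda>_. {{b + c * s | s. s \<in> S} | b c S. S \<in> \<B>}"]
        def_family_affine[OF K F])
      (simp_all add: field_expansion_def)
  then show False using rk by blast
qed

section \<open>A bounded $W_n$-set\<close>

text \<open>
  If \<open>a\<close> shows that the union, for \<open>D\<close> the differences of \<open>m\<close> points \<open>b k\<close> of \<open>U\<close>, is not a
  \<open>W\<^sub>n\<close>-set, then the point \<open>\<Sum>j. a j * b (\<eta> j)\<close> lies in the translate by \<open>a i * b k\<close> of the sum of the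
  other \<open>a j * U\<close> only for \<open>k = \<eta> i\<close>; otherwise one could divide by \<open>b k - b (\<eta> i)\<close>.
\<close>

lemma W_set_ratios:
  fixes K :: "('f, 'r, 'a) fo_structure"
  assumes K: "field_expansion L K" and U: "def_family L K {U}" and inf: "infinite U"
    and rk: "\<not> dp_rank_ge L K (Suc n)"
  shows "\<exists>D. finite D \<and> 0 \<notin> D \<and>
    W_set n (\<Union>d\<in>D. (\<lambda>x. inverse d * x) ` {x - y | x y. x \<in> U \<and> y \<in> U})"
proof (rule ccontr)
  assume none: "\<not> ?thesis"
  obtain b :: "nat \<Rightarrow> 'a" where b: "inj b" "range b \<subseteq> U"
    using inf infinite_countable_subset by blast
  let ?\<F> = "\<lambda>i. {{c + (\<Sum>j\<in>{..n} - {i}. a j * u j) | u. \<forall>j\<in>{..n} - {i}. u j \<in> U} | c a. True}"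
  have "\<exists>S. (\<forall>i<Suc n. \<forall>k<m. S i k \<in> ?\<F> i) \<and>
      (\<forall>\<eta> :: nat \<Rightarrow> nat. (\<forall>i<Suc n. \<eta> i < m) \<longrightarrow>
        (\<exists>x\<in>universe K. \<forall>i<Suc n. \<forall>k<m. x \<in> S i k \<longleftrightarrow> k = \<eta> i))" for m
  proof -
    define D where "D = (\<lambda>(k, l). b k - b l) ` ({..<m} \<times> {..<m}) - {0}"
    define X where "X = (\<Union>d\<in>D. (\<lambda>x. inverse d * x) ` {x - y | x y. x \<in> U \<and> y \<in> U})"
    have "finite D" "0 \<notin> D" by (auto simp: D_def)
    then have "\<not> W_set n X" using none unfolding X_def by blast
    then obtain a where a: "\<And>i x. i \<le> n \<Longrightarrow> (\<forall>j\<in>{..n} - {i}. x j \<in> X) \<Longrightarrow>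
        a i \<noteq> (\<Sum>j\<in>{..n} - {i}. a j * x j)"
      unfolding W_set_def by blast
    define S where "S i k = {a i * b k + (\<Sum>j\<in>{..n} - {i}. a j * u j) | u. \<forall>j\<in>{..n} - {i}. u j \<in> U}"
      for i k
    have "(\<Sum>j\<le>n. a j * b (\<eta> j)) \<in> S i k \<longleftrightarrow> k = \<eta> i"
      if \<eta>: "\<forall>i<Suc n. \<eta> i < m" and i: "i < Suc n" and k: "k < m" for \<eta> i k
    proof -
      have split: "(\<Sum>j\<le>n. a j * b (\<eta> j)) = a i * b (\<eta> i) + (\<Sum>j\<in>{..n} - {i}. a j * b (\<eta> j))"
        using i by (intro sum.remove) auto
      show ?thesis
      proof
        assume "(\<Sum>j\<le>n. a j * b (\<eta> j)) \<in> S i k"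
        then obtain u where u: "\<forall>j\<in>{..n} - {i}. u j \<in> U"
          "(\<Sum>j\<le>n. a j * b (\<eta> j)) = a i * b k + (\<Sum>j\<in>{..n} - {i}. a j * u j)"
          unfolding S_def by blast
        show "k = \<eta> i"
        proof (rule ccontr)
          assume "k \<noteq> \<eta> i"
          define d where "d = b k - b (\<eta> i)"
          have d: "d \<noteq> 0" using \<open>k \<noteq> \<eta> i\<close> b(1) by (auto simp: d_def inj_eq)
          then have "d \<in> D" unfolding D_def d_def using k \<eta> i by force
          have "a i * d = (\<Sum>j\<in>{..n} - {i}. a j * (b (\<eta> j) - u j))"
            using split u(2) by (simp add: d_def right_diff_distrib sum_subtractf) (simp add: algebra_simps)
          moreover have "a i = inverse d * (a i * d)"
            using d by simp
          ultimately have "a i = inverse d * (\<Sum>j\<in>{..n} - {i}. a j * (b (\<eta> j) - u j))"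
            by (simp only:)
          also have "\<dots> = (\<Sum>j\<in>{..n} - {i}. a j * (inverse d * (b (\<eta> j) - u j)))"
            unfolding sum_distrib_left by (intro sum.cong refl mult.left_commute)
          finally have "a i = (\<Sum>j\<in>{..n} - {i}. a j * (inverse d * (b (\<eta> j) - u j)))" .
          moreover have "\<forall>j\<in>{..n} - {i}. inverse d * (b (\<eta> j) - u j) \<in> X"
          proof
            fix j assume "j \<in> {..n} - {i}"
            then have "b (\<eta> j) - u j \<in> {x - y | x y. x \<in> U \<and> y \<in> U}"
              using u(1) b(2) by blast
            then show "inverse d * (b (\<eta> j) - u j) \<in> X"
              unfolding X_def using \<open>d \<in> D\<close> by (intro UN_I[of d] imageI)
          qed
          moreover have "i \<le> n" using i by simp
          ultimately show False using a[of i "\<lambda>j. inverse d * (b (\<eta> j) - u j)"] by blast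
        qed
      next
        assume "k = \<eta> i"
        then show "(\<Sum>j\<le>n. a j * b (\<eta> j)) \<in> S i k"
          unfolding S_def split by (intro CollectI exI[of _ "\<lambda>j. b (\<eta> j)"]) (use b(2) in auto)
      qed
    qed
    moreover have "S i k \<in> ?\<F> i" for i k unfolding S_def by blast
    moreover have "universe K = UNIV" using K by (simp add: field_expansion_def)
    ultimately show ?thesis by (intro exI[of _ S]) auto
  qed
  moreover have "def_family L K (?\<F> i)" for i
    by (rule def_family_weighted_sums[OF K U]) simp
  ultimately have "dp_rank_ge L K (Suc n)"
    using K by (intro dp_rank_ge_if_shattered[where \<F> = ?\<F>]) (simp_all add: field_expansion_def)
  then show False using rk by blast
qed

end

theorem theorem1p12:
  fixes L :: "('f, 'r) language"
    and K :: "('f, 'r, 'a::field) fo_structure"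
    and \<tau> :: "'a topology"
    and n :: nat
  assumes "field_expansion L K"
    and "has_dp_rank L K n"
    and "field_topology \<tau>"
    and "definable_topology L K \<tau>"
  shows "breadth_le \<tau> n"
proof -
  interpret topological_field \<tau> by unfold_locales fact
  have rk: "\<not> dp_rank_ge L K (Suc n)" using assms(2) by (simp add: has_dp_rank_def)
  obtain \<B> where \<B>: "uniformly_definable L K \<B>" "openin \<tau> = arbitrary union_of (\<lambda>B. B \<in> \<B>)"
    using assms(4) by (auto simp: definable_topology_def)
  have fam: "def_family L K \<B>"
    using def_family_uniformly_definable \<B>(1) assms(1) by (auto simp: field_expansion_def)
  have basis: "\<exists>B\<in>\<B>. N B \<and> B \<subseteq> U" if "N U" for U
  proof -
    obtain V where V: "openin \<tau> V" "0 \<in> V" "V \<subseteq> U" using \<open>N U\<close> by (auto simp: nbhd_zero_def)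
    then obtain \<C> where "\<C> \<subseteq> \<B>" "\<Union>\<C> = V" by (auto simp: \<B>(2) union_of_def arbitrary_def)
    then obtain B where B: "B \<in> \<B>" "0 \<in> B" "B \<subseteq> V" using V(2) by blast
    then have "openin \<tau> B"
      unfolding \<B>(2) by (intro union_of_inc) (auto simp: arbitrary_def)
    then show ?thesis using B V(3) by (intro bexI[of _ B]) (auto simp: nbhd_zero_def)
  qed
  have lb: "locally_bounded \<tau>"
    by (rule locally_bounded_if_not_dp_rank_ge[OF assms(1) _ fam rk]) (use basis in blast)
  then obtain U0 where U0: "N U0" "bounded_set \<tau> U0" by (auto simp: locally_bounded_def)
  obtain U where U: "U \<in> \<B>" "N U" "U \<subseteq> U0" using basis[OF U0(1)] by blast
  have "bounded_set \<tau> U"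
    using U0(2) U(3) by (rule bounded_subset)
  have "def_family L K {U}"
    by (rule def_family_mono[OF fam]) (use U(1) in simp)
  obtain D where D: "finite D" "0 \<notin> D" and W:
    "W_set n (\<Union>d\<in>D. (\<lambda>x. inverse d * x) ` {x - y | x y. x \<in> U \<and> y \<in> U})"
    using W_set_ratios[OF assms(1) \<open>def_family L K {U}\<close> N_infinite[OF U(2)] rk]
    by (elim exE conjE)
  have "bounded_set \<tau> (\<Union>d\<in>D. (\<lambda>x. inverse d * x) ` {x - y | x y. x \<in> U \<and> y \<in> U})"
  proof (rule bounded_UN[OF D(1)])
    fix d assume "d \<in> D"
    then have "inverse d \<noteq> 0" using D(2) by auto
    then show "bounded_set \<tau> ((\<lambda>x. inverse d * x) ` {x - y | x y. x \<in> U \<and> y \<in> U})"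
      by (rule bounded_scale[OF bounded_diff[OF \<open>bounded_set \<tau> U\<close>]])
  qed
  then show ?thesis unfolding breadth_le_def using lb W by (intro conjI exI)
qed

end
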